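(* Let $B\in\mathrm{M}_n(\mathbb{R})$ be a skew-symmetrizable matrix satisfying the sign-coherent property. Let (H) denote the assumption that every matrix mutation-equivalent to $B$ satisfies both the sign-coherent property and the discreteness property. (a) (Without assuming (H).) There is a canonical graph isomorphism $\mathbf{EG}(\tilde{\mathbf C}(B))\cong\mathbf{EG}(\tilde{\mathbf G}(B))$. (b) If (H) holds, there are canonical graph isomorphisms $\mathbf{EG}(\tilde{\mathbf C}(B))\cong\mathbf{EG}(\tilde{\mathbf G}(B))\cong\mathbf{EG}(\Delta_{\mathbf G}(B))$. (c) If (H) holds, there is a canonical graph isomorphism $\mathbf{EG}(\mathbf C(B))\cong\mathbf{EG}(\mathbf G(B))$. (d) Suppose (H) holds. Define an equivalence relation $\approx$ on the set of all bases of $\mathbb{R}^n$ by $\{\mathbf u_1,\dots,\mathbf u_n\}\approx\{\mathbf v_1,\dots,\mathbf v_n\}$ if and only if there exist $\sigma\in\mathfrak S_n$ and $\lambda_i\in\mathbb{R}_{>0}$ such that $\mathbf v_{\sigma(i)}=\lambda_i\mathbf u_i$ for all $i$. Identify the vertices of $\mathbf{EG}(\mathbf C(B))$ and $\mathbf{EG}(\mathbf G(B))$ with the clusters $[C_t]$ and $[G_t]$ (which are bases of $\mathbb{R}^n$), so that $\approx$ is an equivalence relation on these vertex sets. Then there are canonical graph isomorphisms $$\mathbf{EG}(\tilde{\mathbf C}(B))\cong\mathbf{EG}(\tilde{\mathbf G}(B))\cong\mathbf{EG}(\Delta_{\mathbf G}(B))\cong\mathbf{EG}(\mathbf C(B))/{\approx}\;\cong\mathbf{EG}(\mathbf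 G(B))/{\approx}.$$
   Context: Fix an integer $n\ge 2$. A matrix $B\in\mathrm{M}_n(\mathbb{R})$ is skew-symmetrizable if there is $D=\mathrm{diag}(d_1,\dots,d_n)$ with all $d_i>0$ (a skew-symmetrizer) such that $DB$ is skew-symmetric. Notation: $[x]_+=\max(x,0)$, applied entrywise to matrices; $J_k$ is the identity matrix with $(k,k)$ entry replaced by $-1$; $A^{k\bullet}$ (resp. $A^{\bullet k}$) is obtained from $A$ by replacing by $0$ all entries outside the $k$th row (resp. $k$th column); $[A]_+^{k\bullet}=([A]_+)^{k\bullet}$ etc. Mutation: $\mu_k(B)=(J_k+[-B]_+^{\bullet k})B(J_k+[B]_+^{k\bullet})$. $\mathbb{T}_n$ is the $n$-regular tree whose edges are labeled by $1,\dots,n$ so that the $n$ edges at each vertex have distinct labels; vertices joined by an edge labeled $k$ are $k$-adjacent. Fix an initial vertex $t_0$. The $B$-pattern $\{B_t\}$ with initial exchange matrix $B$ is given by $B_{t_0}=B$ and $B_{t'}=\mu_k(B_t)$ for $k$-adjacent $t,t'$; its members are the matrices mutation-equivalent to $B$. The $C$-pattern $\mathbf C(B)=\{C_t\}$ and $G$-pattern $\mathbf G(B)=\{G_t\}$ are given by $C_{t_0}=G_{t_0}=I_n$ and, for $k$-adjacent $t,t'$, $$C_{t'}=C_tJ_k+C_t[B_t]_+^{k\bullet}+[-C_t]_+^{\bullet k}B_t,\qquad G_{t'}=G_tJ_k+G_t[-B_t]_+^{\bullet k}-B_{t_0}[-C_t]_+^{\bullet k}.$$ Their columns are the $c$-vectors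 $\mathbf c_{i;t}$ and $g$-vectors $\mathbf g_{i;t}$. For a fixed skew-symmetrizer $D$ of $B$, with $D^{-\frac12}=\mathrm{diag}(\sqrt{d_1}^{-1},\dots,\sqrt{d_n}^{-1})$, the modified patterns $\tilde{\mathbf C}(B)=\{\tilde C_t\}$, $\tilde{\mathbf G}(B)=\{\tilde G_t\}$ are $\tilde C_t=C_tD^{-\frac12}$, $\tilde G_t=G_tD^{-\frac12}$. Sign-coherent property of $B$: every column of every $C_t$ is nonzero with all entries $\ge0$ or all $\le0$, and every row of every $G_t$ is nonzero with all entries $\ge0$ or all $\le0$. Discreteness property of $B$: for every skew-symmetrizer $D=\mathrm{diag}(d_1,\dots,d_n)$ of $B$, if a $c$-vector of $\mathbf C(B)$ satisfies $\mathbf c_{i;t}=\alpha\mathbf e_j$ for some $i,j,t$ and $\alpha\in\mathbb R$, then $\alpha=\pm\sqrt{d_i/d_j}$. $G$-cone: $\mathcal C(G_t)=\{\sum_i\lambda_i\mathbf g_{i;t}\mid\lambda_i\ge0\}$. $\Delta_{\mathbf G}(B)$ denotes the $G$-fan, the set of all $G$-cones together with their faces (cones spanned by subsets of $\{\mathbf g_{1;t},\dots,\mathbf g_{n;t}\}$). For a matrix $A$ write $[A]$ for the set of its columns. For an equivalence relation $\sim$ on the vertices of a graph, the quotient graph has the equivalence classes as vertices, two classes being connected iff some representatives are connected. The exchange graphs are quotient graphs $\mathbb{T}_n/{\sim}$: for $\mathbf{EG}(\mathbf C(B))$, $t\sim t'\iff[C_t]=[C_{t'}]$; for $\mathbf{EG}(\mathbf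 G(B))$, $\mathbf{EG}(\tilde{\mathbf C}(B))$, $\mathbf{EG}(\tilde{\mathbf G}(B))$ the same with $G_t$, $\tilde C_t$, $\tilde G_t$ in place of $C_t$; for $\mathbf{EG}(\Delta_{\mathbf G}(B))$, $t\sim t'\iff\mathcal C(G_t)=\mathcal C(G_{t'})$. The further quotients by $\approx$ are likewise viewed as quotients of $\mathbb{T}_n$ (by $t\sim t'\iff[C_t]\approx[C_{t'}]$, resp. $[G_t]\approx[G_{t'}]$). Two such graphs are canonically isomorphic if the equivalence relations on $\mathbb{T}_n$ defining them coincide. *)

theory Defs
  imports "HOL-Analysis.Analysis"
begin

section \<open>Skew-symmetrizable matrices and mutation\<close>

definition diag_mat :: "real^'n \<Rightarrow> real^'n^'n" where
  "diag_mat d = (\<chi> i j. if i = j then d $ i else 0)"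

definition skew_symmetrizer :: "real^'n \<Rightarrow> real^'n^'n \<Rightarrow> bool" where
  "skew_symmetrizer d B \<longleftrightarrow>
     (\<forall>i. d $ i > 0) \<and> transpose (diag_mat d ** B) = - (diag_mat d ** B)"

definition skew_symmetrizable :: "real^'n^'n \<Rightarrow> bool" where
  "skew_symmetrizable B \<longleftrightarrow> (\<exists>d. skew_symmetrizer d B)"

definition pos_mat :: "real^'n^'n \<Rightarrow> real^'n^'n" where
  "pos_mat A = (\<chi> i j. max (A $ i $ j) 0)"

definition J_mat :: "'n \<Rightarrow> real^'n^'n" where
  "J_mat k = (\<chi> i j. if i = j then (if i = k then -1 else 1) else 0)"

definition row_part :: "'n \<Rightarrow> real^'n^'n \<Rightarrow> real^'n^'n" where
  "row_part k A = (\<chi> i j. if i = k then A $ i $ j else 0)"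

definition col_part :: "'n \<Rightarrow> real^'n^'n \<Rightarrow> real^'n^'n" where
  "col_part k A = (\<chi> i j. if j = k then A $ i $ j else 0)"

definition mutation :: "'n::finite \<Rightarrow> real^'n^'n \<Rightarrow> real^'n^'n" where
  "mutation k B =
     (J_mat k + col_part k (pos_mat (- B))) ** B ** (J_mat k + row_part k (pos_mat B))"


section \<open>The regular tree and the patterns\<close>

text \<open>The edge-labelled regular tree is realised as the set of words in the labels without two
  equal consecutive letters (the Cayley tree of a free product of groups of order two); prepending
  the letter k is traversing the edge labelled k away from the initial vertex, which is the
  empty word.\<close>

definition tree_vertices :: "'n list set" where
  "tree_vertices = {t. distinct_adj t}"

definition k_adjacent :: "'n \<Rightarrow> 'n list \<Rightarrow> 'n list \<Rightarrow> bool" where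
  "k_adjacent k t t' \<longleftrightarrow>
     t \<in> tree_vertices \<and> t' \<in> tree_vertices \<and> (t' = k # t \<or> t = k # t')"

text \<open>The patterns are computed by recursion along the unique path from the initial vertex. That
  the defining relations then hold for every ordered pair of k-adjacent vertices (also when
  moving towards the initial vertex) is shown below in \<open>B_pattern_adjacent\<close>,
  \<open>C_pattern_adjacent\<close> and \<open>G_pattern_adjacent\<close>.\<close>

fun B_pattern :: "real^'n^'n \<Rightarrow> 'n::finite list \<Rightarrow> real^'n^'n" where
  "B_pattern B [] = B"
| "B_pattern B (k # t) = mutation k (B_pattern B t)"

fun C_pattern :: "real^'n^'n \<Rightarrow> 'n::finite list \<Rightarrow> real^'n^'n" where
  "C_pattern B [] = mat 1"
| "C_pattern B (k # t) =
     C_pattern B t ** J_mat k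
     + C_pattern B t ** row_part k (pos_mat (B_pattern B t))
     + col_part k (pos_mat (- C_pattern B t)) ** B_pattern B t"

fun G_pattern :: "real^'n^'n \<Rightarrow> 'n::finite list \<Rightarrow> real^'n^'n" where
  "G_pattern B [] = mat 1"
| "G_pattern B (k # t) =
     G_pattern B t ** J_mat k
     + G_pattern B t ** col_part k (pos_mat (- B_pattern B t))
     - B ** col_part k (pos_mat (- C_pattern B t))"

definition mutation_equivalent :: "real^'n^'n \<Rightarrow> real^'n::finite^'n \<Rightarrow> bool" where
  "mutation_equivalent B B' \<longleftrightarrow> (\<exists>t \<in> tree_vertices. B' = B_pattern B t)"

definition diag_inv_sqrt :: "real^'n \<Rightarrow> real^'n^'n" where
  "diag_inv_sqrt d = diag_mat (\<chi> i. inverse (sqrt (d $ i)))"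

definition mod_C_pattern :: "real^'n \<Rightarrow> real^'n^'n \<Rightarrow> 'n::finite list \<Rightarrow> real^'n^'n" where
  "mod_C_pattern d B t = C_pattern B t ** diag_inv_sqrt d"

definition mod_G_pattern :: "real^'n \<Rightarrow> real^'n^'n \<Rightarrow> 'n::finite list \<Rightarrow> real^'n^'n" where
  "mod_G_pattern d B t = G_pattern B t ** diag_inv_sqrt d"


section \<open>Sign-coherence and discreteness\<close>

definition sign_coherent_vec :: "real^'n \<Rightarrow> bool" where
  "sign_coherent_vec v \<longleftrightarrow> v \<noteq> 0 \<and> ((\<forall>i. v $ i \<ge> 0) \<or> (\<forall>i. v $ i \<le> 0))"

definition sign_coherent :: "real^'n^'n::finite \<Rightarrow> bool" where
  "sign_coherent B \<longleftrightarrow>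
     (\<forall>t \<in> tree_vertices. \<forall>i. sign_coherent_vec (column i (C_pattern B t))
                           \<and> sign_coherent_vec (row i (G_pattern B t)))"

definition discrete :: "real^'n^'n::finite \<Rightarrow> bool" where
  "discrete B \<longleftrightarrow>
     (\<forall>d. skew_symmetrizer d B \<longrightarrow>
       (\<forall>t \<in> tree_vertices. \<forall>i j \<alpha>.
          column i (C_pattern B t) = \<alpha> *\<^sub>R axis j 1 \<longrightarrow>
          \<alpha> = sqrt (d $ i / d $ j) \<or> \<alpha> = - sqrt (d $ i / d $ j)))"

definition hypothesis_H :: "real^'n^'n::finite \<Rightarrow> bool" where
  "hypothesis_H B \<longleftrightarrow> (\<forall>B'. mutation_equivalent B B' \<longrightarrow> sign_coherent B' \<and> discrete B')"


section \<open>Quotient graphs of the tree and exchange graphs\<close>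

record 'v graph =
  graph_verts :: "'v set"
  graph_edges :: "('v \<times> 'v) set"

definition quotient_graph :: "('n list \<times> 'n list) set \<Rightarrow> 'n list set graph" where
  "quotient_graph r =
     \<lparr> graph_verts = tree_vertices // r,
       graph_edges = {(X, Y). X \<in> tree_vertices // r \<and> Y \<in> tree_vertices // r \<and>
                              (\<exists>t \<in> X. \<exists>t' \<in> Y. \<exists>k. k_adjacent k t t')} \<rparr>"

text \<open>The vertices of a quotient graph are classes of tree vertices, so the relation by which the
  quotient was formed can be read off from them; see \<open>same_class_quotient_graph\<close> below. Quotient
  graphs are canonically isomorphic iff these relations on the tree coincide.\<close>

definition same_class :: "'n list set graph \<Rightarrow> ('n list \<times> 'n list) set" where
  "same_class \<Gamma> = {(t, t'). \<exists>X \<in> graph_verts \<Gamma>. t \<in> X \<and> t' \<in> X}"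

definition canonically_isomorphic :: "'n list set graph \<Rightarrow> 'n list set graph \<Rightarrow> bool"
    (infix "\<cong>\<^sub>c" 50) where
  "\<Gamma> \<cong>\<^sub>c \<Gamma>' \<longleftrightarrow> same_class \<Gamma> = same_class \<Gamma>'"

definition cluster_graph :: "('n::finite list \<Rightarrow> real^'n^'n) \<Rightarrow> 'n list set graph" where
  "cluster_graph X = quotient_graph
     {(t, t'). t \<in> tree_vertices \<and> t' \<in> tree_vertices \<and> columns (X t) = columns (X t')}"

definition EG_C :: "real^'n^'n \<Rightarrow> 'n::finite list set graph" where
  "EG_C B = cluster_graph (C_pattern B)"

definition EG_G :: "real^'n^'n \<Rightarrow> 'n::finite list set graph" where
  "EG_G B = cluster_graph (G_pattern B)"

definition EG_mod_C :: "real^'n \<Rightarrow> real^'n^'n \<Rightarrow> 'n::finite list set graph" where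
  "EG_mod_C d B = cluster_graph (mod_C_pattern d B)"

definition EG_mod_G :: "real^'n \<Rightarrow> real^'n^'n \<Rightarrow> 'n::finite list set graph" where
  "EG_mod_G d B = cluster_graph (mod_G_pattern d B)"

definition G_cone :: "real^'n^'n::finite \<Rightarrow> (real^'n) set" where
  "G_cone G = {\<Sum>i\<in>UNIV. l i *\<^sub>R column i G | l. \<forall>i. l i \<ge> 0}"

definition EG_fan :: "real^'n^'n \<Rightarrow> 'n::finite list set graph" where
  "EG_fan B = quotient_graph
     {(t, t'). t \<in> tree_vertices \<and> t' \<in> tree_vertices \<and>
               G_cone (G_pattern B t) = G_cone (G_pattern B t')}"

definition is_basis :: "(real^'n::finite) set \<Rightarrow> bool" where
  "is_basis U \<longleftrightarrow> independent U \<and> span U = UNIV"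

definition scaling_equiv :: "((real^'n::finite) set \<times> (real^'n) set) set" where
  "scaling_equiv =
     {(U, V). is_basis U \<and> is_basis V \<and>
        (\<exists>(u :: 'n \<Rightarrow> real^'n) (v :: 'n \<Rightarrow> real^'n) \<sigma> l.
           bij_betw u UNIV U \<and> bij_betw v UNIV V \<and> \<sigma> permutes UNIV \<and>
           (\<forall>i. l i > 0 \<and> v (\<sigma> i) = l i *\<^sub>R u i))}"

definition scaled_cluster_graph :: "('n::finite list \<Rightarrow> real^'n^'n) \<Rightarrow> 'n list set graph" where
  "scaled_cluster_graph X = quotient_graph
     {(t, t'). t \<in> tree_vertices \<and> t' \<in> tree_vertices \<and>
               (columns (X t), columns (X t')) \<in> scaling_equiv}"

definition EG_C_scaled :: "real^'n^'n \<Rightarrow> 'n::finite list set graph" where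
  "EG_C_scaled B = scaled_cluster_graph (C_pattern B)"

definition EG_G_scaled :: "real^'n^'n \<Rightarrow> 'n::finite list set graph" where
  "EG_G_scaled B = scaled_cluster_graph (G_pattern B)"


section \<open>Well-definedness\<close>

lemma tree_regular:
  assumes "t \<in> tree_vertices"
  shows "\<exists>!t'. k_adjacent k t t'"
proof (cases t)
  case Nil
  then show ?thesis
    by (auto simp: k_adjacent_def tree_vertices_def)
next
  case (Cons a s)
  show ?thesis
  proof (cases "a = k")
    case True
    show ?thesis
    proof (rule ex1I[of _ s])
      show "k_adjacent k t s" using Cons assms True
        by (auto simp: k_adjacent_def tree_vertices_def distinct_adj_Cons)
      show "t' = s" if "k_adjacent k t t'" for t'
        using that Cons True by (auto simp: k_adjacent_def tree_vertices_def distinct_adj_Cons)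
    qed
  next
    case False
    then show ?thesis using Cons assms
      by (auto simp: k_adjacent_def tree_vertices_def distinct_adj_Cons)
  qed
qed

lemma same_class_quotient_graph:
  assumes "r \<subseteq> tree_vertices \<times> tree_vertices" "sym r" "trans r"
  shows "same_class (quotient_graph r) = r"
proof (rule set_eqI, clarify)
  fix t t'
  show "(t, t') \<in> same_class (quotient_graph r) \<longleftrightarrow> (t, t') \<in> r"
  proof
    assume "(t, t') \<in> same_class (quotient_graph r)"
    then obtain u where "(u, t) \<in> r" "(u, t') \<in> r"
      unfolding same_class_def quotient_graph_def quotient_def by auto
    then show "(t, t') \<in> r"
      by (meson assms(2,3) symD transD)
  next
    assume tt: "(t, t') \<in> r"
    then have "(t, t) \<in> r" "t \<in> tree_vertices"
      using assms(1) by (meson assms(2,3) symD transD, blast)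
    then have "r `` {t} \<in> graph_verts (quotient_graph r)" "t \<in> r `` {t}" "t' \<in> r `` {t}"
      using tt by (simp_all add: quotient_graph_def quotientI)
    then show "(t, t') \<in> same_class (quotient_graph r)"
      unfolding same_class_def by blast
  qed
qed

lemma equiv_scaling_equiv: "equiv {U :: (real^'n::finite) set. is_basis U} scaling_equiv"
proof (rule equivI)
  show "scaling_equiv \<subseteq> {U :: (real^'n) set. is_basis U} \<times> {U. is_basis U}"
    by (auto simp: scaling_equiv_def)
  show "refl_on {U :: (real^'n) set. is_basis U} scaling_equiv"
  proof (rule refl_onI)
    fix U :: "(real^'n) set"
    assume "U \<in> {U. is_basis U}"
    then have U: "independent U" "span U = UNIV" by (auto simp: is_basis_def)
    have "finite U" using U(1) by (simp add: independent_imp_finite)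
    moreover have "card U = CARD('n)"
      using U by (metis dim_UNIV dim_eq_card DIM_cart DIM_real mult.right_neutral span_UNIV)
    ultimately obtain u where u: "bij_betw u (UNIV :: 'n set) U"
      using finite_same_card_bij[of "UNIV :: 'n set" U] by auto
    have "\<exists>(u :: 'n \<Rightarrow> real^'n) (v :: 'n \<Rightarrow> real^'n) \<sigma> l.
        bij_betw u UNIV U \<and> bij_betw v UNIV U \<and> \<sigma> permutes UNIV \<and>
        (\<forall>i. l i > 0 \<and> v (\<sigma> i) = l i *\<^sub>R u i)"
      using u permutes_id by (intro exI[of _ u] exI[of _ id] exI[of _ "\<lambda>_. 1"]) auto
    then show "(U, U) \<in> scaling_equiv"
      using U by (simp add: scaling_equiv_def is_basis_def)
  qed
  show "sym (scaling_equiv :: ((real^'n) set \<times> (real^'n) set) set)"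
  proof (rule symI)
    fix U V :: "(real^'n) set"
    assume "(U, V) \<in> scaling_equiv"
    then obtain u v :: "'n \<Rightarrow> real^'n" and \<sigma> l where
      b: "is_basis U" "is_basis V" "bij_betw u UNIV U" "bij_betw v UNIV V" "\<sigma> permutes UNIV"
      and l: "\<And>i. l i > 0" "\<And>i. v (\<sigma> i) = l i *\<^sub>R u i"
      unfolding scaling_equiv_def by blast
    define l' where "l' = (\<lambda>i. inverse (l (inv \<sigma> i)))"
    have "u (inv \<sigma> i) = l' i *\<^sub>R v i" for i
    proof -
      have "v i = l (inv \<sigma> i) *\<^sub>R u (inv \<sigma> i)"
        using l(2)[of "inv \<sigma> i"] permutes_inverses(1)[OF b(5)] by simp
      then show ?thesis using l(1)[of "inv \<sigma> i"] by (simp add: l'_def)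
    qed
    moreover have "l' i > 0" for i using l(1) by (simp add: l'_def)
    ultimately have "\<exists>(u :: 'n \<Rightarrow> real^'n) (v :: 'n \<Rightarrow> real^'n) \<sigma> l.
        bij_betw u UNIV V \<and> bij_betw v UNIV U \<and> \<sigma> permutes UNIV \<and>
        (\<forall>i. l i > 0 \<and> v (\<sigma> i) = l i *\<^sub>R u i)"
      using b permutes_inv[OF b(5)]
      by (intro exI[of _ v] exI[of _ u] exI[of _ "inv \<sigma>"] exI[of _ l']) auto
    then show "(V, U) \<in> scaling_equiv" using b by (simp add: scaling_equiv_def)
  qed
  show "trans (scaling_equiv :: ((real^'n) set \<times> (real^'n) set) set)"
  proof (rule transI)
    fix U V W :: "(real^'n) set"
    assume "(U, V) \<in> scaling_equiv" "(V, W) \<in> scaling_equiv"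
    then obtain u v v' w :: "'n \<Rightarrow> real^'n" and \<sigma> l \<tau> m where
      b: "is_basis U" "is_basis W" "bij_betw u UNIV U" "bij_betw v UNIV V" "\<sigma> permutes UNIV"
         "bij_betw v' UNIV V" "bij_betw w UNIV W" "\<tau> permutes UNIV"
      and l: "\<And>i. l i > 0" "\<And>i. v (\<sigma> i) = l i *\<^sub>R u i"
             "\<And>i. m i > 0" "\<And>i. w (\<tau> i) = m i *\<^sub>R v' i"
      unfolding scaling_equiv_def by blast
    define \<rho> where "\<rho> = inv_into UNIV v' \<circ> v"
    have "bij \<rho>"
      unfolding \<rho>_def using bij_betw_trans[OF b(4) bij_betw_inv_into[OF b(6)]] .
    then have \<rho>: "\<rho> permutes UNIV" by (simp add: permutes_def bij_iff)
    have v': "v' (\<rho> i) = v i" for i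
      
    proof -
      have "v i \<in> v' ` UNIV" using b(4,6) by (auto simp: bij_betw_def)
      then show ?thesis by (simp add: \<rho>_def f_inv_into_f)
    qed
    define \<pi> where "\<pi> = \<tau> \<circ> (\<rho> \<circ> \<sigma>)"
    have \<pi>: "\<pi> permutes UNIV"
      unfolding \<pi>_def by (intro permutes_compose b \<rho>)
    define q where "q = (\<lambda>i. m (\<rho> (\<sigma> i)) * l i)"
    have "w (\<pi> i) = q i *\<^sub>R u i" "q i > 0" for i
      using l by (simp_all add: \<pi>_def q_def v')
    then have "\<exists>(u :: 'n \<Rightarrow> real^'n) (v :: 'n \<Rightarrow> real^'n) \<sigma> l.
        bij_betw u UNIV U \<and> bij_betw v UNIV W \<and> \<sigma> permutes UNIV \<and>
        (\<forall>i. l i > 0 \<and> v (\<sigma> i) = l i *\<^sub>R u i)"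
      using b \<pi> by (intro exI[of _ u] exI[of _ w] exI[of _ \<pi>] exI[of _ q]) auto
    then show "(U, W) \<in> scaling_equiv" using b by (simp add: scaling_equiv_def)
  qed
qed

lemma matrix_add_right_distrib: "((A :: real^'n^'m) + B) ** (C :: real^'k^'n) = A ** C + B ** C"
  by (simp add: matrix_matrix_mult_def vec_eq_iff distrib_right sum.distrib)

lemma row_part_mult: "(A ** row_part k X) $ i $ j = A $ i $ k * X $ k $ j"
proof -
  have "A $ i $ l * row_part k X $ l $ j = (if l = k then A $ i $ k * X $ k $ j else 0)" for l
    by (simp add: row_part_def)
  then show ?thesis by (simp add: matrix_matrix_mult_def)
qed

lemma col_part_mult: "(col_part k X ** A) $ i $ j = X $ i $ k * A $ k $ j"
proof -
  have "col_part k X $ i $ l * A $ l $ j = (if l = k then X $ i $ k * A $ k $ j else 0)" for l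
    by (simp add: col_part_def)
  then show ?thesis by (simp add: matrix_matrix_mult_def)
qed

lemma mult_col_part: "(A ** col_part k X) $ i $ j = (if j = k then (\<Sum>l\<in>UNIV. A $ i $ l * X $ l $ k) else 0)"
  by (simp add: matrix_matrix_mult_def col_part_def)

lemma mult_J: "(A ** J_mat k) $ i $ j = (if j = k then - A $ i $ j else A $ i $ j)"
proof -
  have "A $ i $ l * J_mat k $ l $ j = (if l = j then (if j = k then - A $ i $ j else A $ i $ j) else 0)" for l
    by (simp add: J_mat_def)
  then show ?thesis by (simp add: matrix_matrix_mult_def)
qed

lemma J_mult: "(J_mat k ** A) $ i $ j = (if i = k then - A $ i $ j else A $ i $ j)"
proof -
  have "J_mat k $ i $ l * A $ l $ j = (if l = i then (if i = k then - A $ i $ j else A $ i $ j) else 0)" for l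
    by (simp add: J_mat_def)
  then show ?thesis by (simp add: matrix_matrix_mult_def)
qed

lemma mutation_entry:
  assumes "B $ k $ k = 0"
  shows "mutation k B $ i $ j =
    (if i = k \<or> j = k then - B $ i $ j
     else B $ i $ j + max (- B $ i $ k) 0 * B $ k $ j + B $ i $ k * max (B $ k $ j) 0)"
  using assms
  by (auto simp: mutation_def matrix_add_ldistrib matrix_add_right_distrib row_part_mult
      col_part_mult mult_J J_mult pos_mat_def)

lemma skew_symmetrizer_entry:
  "skew_symmetrizer d B \<longleftrightarrow> (\<forall>i. d $ i > 0) \<and> (\<forall>i j. d $ j * B $ j $ i = - (d $ i * B $ i $ j))"
proof -
  have "(diag_mat d ** B) $ i $ j = d $ i * B $ i $ j" for i j
  proof -
    have "diag_mat d $ i $ l * B $ l $ j = (if l = i then d $ i * B $ i $ j else 0)" for l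
      by (simp add: diag_mat_def)
    then show ?thesis by (simp add: matrix_matrix_mult_def)
  qed
  then show ?thesis by (simp add: skew_symmetrizer_def vec_eq_iff transpose_def)
qed

lemma skew_symmetrizer_diag:
  assumes "skew_symmetrizer d B" shows "B $ k $ k = 0"
proof -
  have "d $ k * B $ k $ k = - (d $ k * B $ k $ k)" "d $ k > 0"
    using assms unfolding skew_symmetrizer_entry by blast+
  then have "d $ k * B $ k $ k = 0" "d $ k \<noteq> 0" by linarith+
  then show ?thesis by simp
qed

lemma skew_symmetrizer_mutation:
  assumes "skew_symmetrizer d B"
  shows "skew_symmetrizer d (mutation k B)"
proof -
  have d: "d $ i > 0" and s: "d $ j * B $ j $ i = - (d $ i * B $ i $ j)" for i j
    using assms unfolding skew_symmetrizer_entry by blast+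
  note z = skew_symmetrizer_diag[OF assms, of k]
  have "d $ j * mutation k B $ j $ i = - (d $ i * mutation k B $ i $ j)" for i j
  proof (cases "i = k \<or> j = k")
    case True
    then have "mutation k B $ j $ i = - B $ j $ i" "mutation k B $ i $ j = - B $ i $ j"
      by (auto simp: mutation_entry[OF z])
    then show ?thesis using s[of j i] by simp
  next
    case False
    have nz: "d $ i \<noteq> 0" "d $ j \<noteq> 0" "d $ k \<noteq> 0"
      using d[of i] d[of j] d[of k] by simp_all
    have e: "B $ b $ a = - (d $ a / d $ b * B $ a $ b)" for a b
    proof -
      have "B $ b $ a = d $ b * B $ b $ a / d $ b" using d[of b] by simp
      then show ?thesis unfolding s[of b a] by simp
    qed
    have m: "max (c * x) 0 = c * max x 0" if "c > 0" for c x :: real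
      using that by (auto simp: max_def zero_le_mult_iff mult_le_0_iff)
    define p where "p = max (- B $ i $ k) 0"
    define q where "q = max (B $ k $ j) 0"
    have m1: "max (- B $ j $ k) 0 = d $ k / d $ j * q"
      using m[of "d $ k / d $ j" "B $ k $ j"] d by (simp add: e[of j k] q_def)
    have m2: "max (B $ k $ i) 0 = d $ i / d $ k * p"
      using m[of "d $ i / d $ k" "- B $ i $ k"] d by (simp add: e[of k i] p_def)
    have M1: "mutation k B $ j $ i = - (d $ i / d $ j * B $ i $ j) - d $ k / d $ j * q * (d $ i / d $ k * B $ i $ k)
        - d $ k / d $ j * B $ k $ j * (d $ i / d $ k * p)"
      using False unfolding mutation_entry[OF z] m1 m2
      by (simp add: e[of j k] e[of k i] e[of j i])
    have M2: "mutation k B $ i $ j = B $ i $ j + p * B $ k $ j + B $ i $ k * q"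
      using False unfolding mutation_entry[OF z] by (simp add: p_def q_def)
    show ?thesis unfolding M1 M2 using nz by (simp add: field_simps)
  qed
  then show ?thesis using d unfolding skew_symmetrizer_entry by blast
qed

lemma skew_symmetrizer_B_pattern:
  "skew_symmetrizer d B \<Longrightarrow> skew_symmetrizer d (B_pattern B t)"
  by (induction t) (auto intro: skew_symmetrizer_mutation)

lemma max_neg: "max (- x) 0 = max x 0 - (x :: real)"
  by (auto simp: max_def)

lemma mutation_mutation:
  assumes "B $ k $ k = 0"
  shows "mutation k (mutation k B) = B"
proof -
  have "mutation k B $ k $ k = 0" using assms by (simp add: mutation_entry)
  then show ?thesis
    by (auto simp: vec_eq_iff mutation_entry assms max_neg algebra_simps)
qed

lemma B_pattern_adjacent:
  assumes "skew_symmetrizable B" "k_adjacent k t t'"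
  shows "B_pattern B t' = mutation k (B_pattern B t)"
proof -
  obtain d where d: "skew_symmetrizer d B"
    using assms by (auto simp: skew_symmetrizable_def)
  have "mutation k (mutation k (B_pattern B s)) = B_pattern B s" for s
    using mutation_mutation[OF skew_symmetrizer_diag[OF skew_symmetrizer_B_pattern[OF d]]] .
  then show ?thesis using assms(2) by (auto simp: k_adjacent_def)
qed

lemma C_entry:
  assumes "B $ k $ k = 0"
  shows "(C ** J_mat k + C ** row_part k (pos_mat B) + col_part k (pos_mat (- C)) ** B) $ i $ j =
    (if j = k then - C $ i $ k
     else C $ i $ j + C $ i $ k * max (B $ k $ j) 0 + max (- C $ i $ k) 0 * B $ k $ j)"
  using assms by (simp add: mult_J row_part_mult col_part_mult pos_mat_def)

lemma C_pattern_adjacent: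
  assumes "skew_symmetrizable B" "k_adjacent k t t'"
  shows "C_pattern B t' =
     C_pattern B t ** J_mat k
     + C_pattern B t ** row_part k (pos_mat (B_pattern B t))
     + col_part k (pos_mat (- C_pattern B t)) ** B_pattern B t"
proof (cases "t' = k # t")
  case False
  then have t: "t = k # t'" using assms by (auto simp: k_adjacent_def)
  define C where "C = C_pattern B t'"
  define A where "A = B_pattern B t'"
  define C' where "C' = C_pattern B t"
  define A' where "A' = B_pattern B t"
  have z: "A $ k $ k = 0"
    using assms skew_symmetrizer_diag skew_symmetrizer_B_pattern
    unfolding skew_symmetrizable_def A_def by blast
  have A': "A' $ k $ j = - A $ k $ j" for j
    using z by (simp add: A'_def t A_def mutation_entry)
  then have z': "A' $ k $ k = 0" using z by simp
  have C': "C' $ i $ j = (if j = k then - C $ i $ k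
     else C $ i $ j + C $ i $ k * max (A $ k $ j) 0 + max (- C $ i $ k) 0 * A $ k $ j)" for i j
    unfolding C'_def t C_pattern.simps C_def A_def by (rule C_entry[OF z[unfolded A_def]])
  have "C $ i $ j = (C' ** J_mat k + C' ** row_part k (pos_mat A') + col_part k (pos_mat (- C')) ** A') $ i $ j" for i j
    unfolding C_entry[OF z'] C' A' by (simp add: max_neg algebra_simps)
  then show ?thesis unfolding vec_eq_iff C_def A'_def C'_def by blast
qed simp

lemma GB_eq_BC:
  assumes "skew_symmetrizable B"
  shows "G_pattern B t ** B_pattern B t = B ** C_pattern B t"
proof (induction t)
  case (Cons k t)
  define G where "G = G_pattern B t"
  define C where "C = C_pattern B t"
  define A where "A = B_pattern B t"
  define N where "N = col_part k (pos_mat (- C))"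
  define P where "P = J_mat k + col_part k (pos_mat (- A))"
  define Q where "Q = J_mat k + row_part k (pos_mat A)"
  have z: "A $ k $ k = 0"
    using assms skew_symmetrizer_diag skew_symmetrizer_B_pattern
    unfolding skew_symmetrizable_def A_def by blast
  have PP: "P ** X = (\<chi> i j. if i = k then - X $ k $ j else X $ i $ j + max (- A $ i $ k) 0 * X $ k $ j)" for X
    using z by (auto simp: P_def vec_eq_iff matrix_add_right_distrib J_mult col_part_mult pos_mat_def)
  have P2: "P ** (P ** X) = X" for X
    unfolding PP by (auto simp: vec_eq_iff)
  have NP: "N ** (P ** X) = - (N ** X)" for X
    unfolding PP N_def by (auto simp: vec_eq_iff col_part_mult)
  have NQ: "N ** (A ** Q) = N ** A"
    using z by (auto simp: N_def Q_def vec_eq_iff matrix_add_ldistrib matrix_mul_assoc mult_J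
        row_part_mult col_part_mult)
  have G': "G_pattern B (k # t) = G ** P - B ** N"
    by (simp add: G_def C_def A_def P_def N_def matrix_add_ldistrib)
  have C': "C_pattern B (k # t) = C ** Q + N ** A"
    by (simp add: G_def C_def A_def Q_def N_def matrix_add_ldistrib)
  have B': "B_pattern B (k # t) = P ** (A ** Q)"
    by (simp add: mutation_def A_def P_def Q_def matrix_mul_assoc)
  have IH: "G ** A = B ** C" using Cons by (simp add: G_def A_def C_def)
  have sub: "(X - Y) ** Z = X ** Z - Y ** Z" for X Y Z :: "real^'a^'a"
    by (simp add: matrix_matrix_mult_def vec_eq_iff left_diff_distrib sum_subtractf)
  have neg: "X ** (- Y) = - (X ** Y)" for X Y :: "real^'a^'a"
    by (simp add: matrix_matrix_mult_def vec_eq_iff sum_negf)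
  have "(G ** P - B ** N) ** (P ** (A ** Q)) = G ** (P ** (P ** (A ** Q))) - B ** (N ** (P ** (A ** Q)))"
    by (simp add: sub matrix_mul_assoc)
  also have "\<dots> = G ** (A ** Q) + B ** (N ** A)"
    by (simp add: P2 NP NQ neg)
  also have "\<dots> = B ** (C ** Q + N ** A)"
    using IH by (simp add: matrix_add_ldistrib matrix_mul_assoc)
  finally show ?case unfolding G' B' C' .
qed simp

lemma G_entry:
  "(G ** J_mat k + G ** col_part k (pos_mat (- A)) - B ** col_part k (pos_mat (- C))) $ i $ j =
    (if j = k then - G $ i $ k + (\<Sum>l\<in>UNIV. G $ i $ l * max (- A $ l $ k) 0)
                   - (\<Sum>l\<in>UNIV. B $ i $ l * max (- C $ l $ k) 0)
     else G $ i $ j)"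
  by (simp add: mult_J mult_col_part pos_mat_def)

lemma G_pattern_adjacent:
  assumes "skew_symmetrizable B" "k_adjacent k t t'"
  shows "G_pattern B t' =
     G_pattern B t ** J_mat k
     + G_pattern B t ** col_part k (pos_mat (- B_pattern B t))
     - B ** col_part k (pos_mat (- C_pattern B t))"
proof (cases "t' = k # t")
  case False
  then have t: "t = k # t'" using assms by (auto simp: k_adjacent_def)
  define G where "G = G_pattern B t'"
  define C where "C = C_pattern B t'"
  define A where "A = B_pattern B t'"
  define G' where "G' = G_pattern B t"
  define C' where "C' = C_pattern B t"
  define A' where "A' = B_pattern B t"
  have z: "A $ k $ k = 0"
    using assms skew_symmetrizer_diag skew_symmetrizer_B_pattern
    unfolding skew_symmetrizable_def A_def by blast
  have A': "A' $ l $ k = - A $ l $ k" for l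
    using z by (simp add: A'_def t A_def mutation_entry)
  have C': "C' $ l $ k = - C $ l $ k" for l
    using z by (simp add: C'_def t A_def C_def C_entry del: vector_add_component)
  have G': "G' $ i $ j = (if j = k then - G $ i $ k + (\<Sum>l\<in>UNIV. G $ i $ l * max (- A $ l $ k) 0)
                   - (\<Sum>l\<in>UNIV. B $ i $ l * max (- C $ l $ k) 0)
     else G $ i $ j)" for i j
    unfolding G'_def t G_def A_def C_def G_pattern.simps by (rule G_entry)
  have gb: "(\<Sum>l\<in>UNIV. G $ i $ l * A $ l $ k) = (\<Sum>l\<in>UNIV. B $ i $ l * C $ l $ k)" for i
    using GB_eq_BC[OF assms(1), of t']
    by (simp add: G_def A_def C_def matrix_matrix_mult_def vec_eq_iff)
  have s: "(\<Sum>l\<in>UNIV. G' $ i $ l * max (A $ l $ k) 0) = (\<Sum>l\<in>UNIV. G $ i $ l * max (A $ l $ k) 0)" for i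
    using z by (intro sum.cong) (auto simp: G')
  have "G $ i $ j = (G' ** J_mat k + G' ** col_part k (pos_mat (- A')) - B ** col_part k (pos_mat (- C'))) $ i $ j" for i j
  proof (cases "j = k")
    case True
    have "G' $ i $ k = - G $ i $ k + (\<Sum>l\<in>UNIV. G $ i $ l * max (- A $ l $ k) 0)
                   - (\<Sum>l\<in>UNIV. B $ i $ l * max (- C $ l $ k) 0)"
      by (simp add: G')
    then show ?thesis
      unfolding G_entry A' C' using gb[of i] True
      by (simp add: s max_neg right_diff_distrib sum_subtractf)
  next
    case False
    then show ?thesis unfolding G_entry by (simp add: G')
  qed
  then show ?thesis unfolding vec_eq_iff G_def G'_def A'_def C'_def by blast
qed simp

end

theory Submission
  imports Defs
begin

text \<open>
  All the exchange graphs compare two vertices \<open>t\<close>, \<open>t'\<close> by asking whether two bases agree up to a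
  permutation \<open>\<sigma>\<close> and positive factors \<open>l\<close>, i.e. whether the \<open>i\<close>-th vector of the second basis is
  \<open>l i\<close> times the \<open>\<sigma> i\<close>-th vector of the first. The graphs differ only in which factors are
  admitted: \<open>l i = 1\<close> for the clusters, \<open>l i = sqrt (d i / d (\<sigma> i))\<close> for the modified clusters, and any
  positive \<open>l i\<close> for the scaled clusters and for the cones, since a simplicial cone determines its
  extremal rays. This is the content of \<open>columns_eq_iff\<close>, \<open>columns_diag_inv_sqrt_eq_iff\<close>,
  \<open>scaling_equiv_columns_iff\<close> and \<open>G_cone_eq_iff\<close>.

  C- and G-matrices are compared through the duality \<open>G\<^sup>T D C = D\<close>, which sign-coherence of the
  c-vectors gives by induction along the tree (\<open>dual_bases_patterns\<close>). By uniqueness of dual bases, a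
  relation \<open>(\<sigma>, l)\<close> between two C-matrices is the same as the relation with \<open>\<sigma>\<close> and
  \<open>d i / (d (\<sigma> i) * l i)\<close> between the G-matrices. The modified factors are fixed by this
  correspondence, so the modified graphs agree under sign-coherence alone.

  Everything else follows from a rigidity statement (\<open>C_pattern_scaling_rigid\<close>): under the hypothesis
  on all matrices of the mutation class, every relation \<open>(\<sigma>, l)\<close> between \<open>C\<^sub>t\<close> and \<open>C\<^sub>t'\<close> already
  has \<open>l i = sqrt (d i / d (\<sigma> i))\<close>. To see this, move the initial vertex along the path to \<open>t\<close>. If
  the initial vertex moves along an edge labelled \<open>k\<close>, every C-matrix is multiplied on the left by
  one of two matrices, chosen by the common sign of the \<open>k\<close>-th row of the G-matrix
  (\<open>C_pattern_change_initial\<close>). Positive rescaling and permutation of columns do not change the sign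
  of a row, so both sides are multiplied by the same matrix and the relation \<open>(\<sigma>, l)\<close> survives
  unchanged. Once \<open>t\<close> is initial its C-matrix is the identity, hence the c-vectors at \<open>t'\<close> are the
  \<open>l i\<close> multiples of coordinate vectors, and discreteness together with \<open>l i > 0\<close> gives the value of \<open>l i\<close>.
\<close>


section \<open>Linear algebra: bases up to permutation and positive rescaling\<close>

definition monomial_related ::
    "('n \<Rightarrow> 'n) \<Rightarrow> ('n \<Rightarrow> real) \<Rightarrow> real^'n^'n \<Rightarrow> real^'n^'n \<Rightarrow> bool" where
  "monomial_related \<sigma> l X X' \<longleftrightarrow>
     bij \<sigma> \<and> (\<forall>i. l i > 0 \<and> column i X' = l i *\<^sub>R column (\<sigma> i) X)"

lemma monomial_related_sym:
  assumes "monomial_related \<sigma> l X X'"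
  shows "monomial_related (inv \<sigma>) (\<lambda>i. inverse (l (inv \<sigma> i))) X' X"
proof -
  have \<sigma>: "bij \<sigma>" and l: "l i > 0" and c: "column i X' = l i *\<^sub>R column (\<sigma> i) X" for i
    using assms by (auto simp: monomial_related_def)
  have "column i X = inverse (l (inv \<sigma> i)) *\<^sub>R column (inv \<sigma> i) X'" for i
    using l[of "inv \<sigma> i"] by (simp add: c bij_is_surj[OF \<sigma>] surj_f_inv_f)
  then show ?thesis
    using l \<sigma> by (simp add: monomial_related_def bij_imp_bij_inv)
qed

lemma inj_column:
  assumes "invertible (X :: real^'n::finite^'n)"
  shows "inj (\<lambda>i. column i X)"
proof (rule injI)
  fix i j assume "column i X = column j X"
  then have "X *v axis i 1 = X *v axis j 1" by (simp add: matrix_vector_mult_basis)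
  then have "axis i (1::real) = axis j 1"
    using inj_matrix_vector_mult[OF assms] by (simp add: inj_eq)
  then show "i = j" by (simp add: axis_eq_axis)
qed

lemma columns_range: "columns X = range (\<lambda>i. column i X)"
  by (auto simp: columns_def)

text \<open>The columns span because the matrix is right invertible, and there are no more of them than
  the dimension allows.\<close>

lemma is_basis_columns:
  assumes "invertible (X :: real^'n::finite^'n)"
  shows "is_basis (columns X)"
proof -
  obtain R where "X ** R = mat 1" using assms by (auto simp: invertible_def)
  then have sp: "span (columns X) = UNIV"
    using matrix_right_invertible_span_columns[of X] span_vec_eq by auto
  have "card (columns X) = CARD('n)"
    unfolding columns_range using inj_column[OF assms] by (simp add: card_image)
  moreover have "finite (columns X)" by (simp add: columns_range)
  ultimately have "independent (columns X)"
    by (intro card_le_dim_spanning[of _ UNIV]) (simp_all add: sp)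
  then show ?thesis using sp by (simp add: is_basis_def)
qed

lemma columns_eq_iff:
  assumes "invertible (X :: real^'n::finite^'n)" "invertible X'"
  shows "columns X = columns X' \<longleftrightarrow> (\<exists>\<sigma>. monomial_related \<sigma> (\<lambda>_. 1) X X')"
proof
  assume eq: "columns X = columns X'"
  let ?c = "\<lambda>i. column i X" and ?c' = "\<lambda>i. column i X'"
  define \<sigma> where "\<sigma> = inv_into UNIV ?c \<circ> ?c'"
  have b: "bij_betw ?c UNIV (columns X)" "bij_betw ?c' UNIV (columns X)"
    using inj_column[OF assms(1)] inj_column[OF assms(2)] columns_range[of X] columns_range[of X'] eq
    by (simp_all add: bij_betw_def)
  then have "bij \<sigma>"
    unfolding \<sigma>_def using bij_betw_trans[OF b(2) bij_betw_inv_into[OF b(1)]] by simp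
  moreover have "?c (\<sigma> i) = ?c' i" for i
  proof -
    have "?c' i \<in> range ?c" using eq columns_range[of X] columns_range[of X'] by auto
    then show ?thesis using f_inv_into_f[of "?c' i" ?c UNIV] by (simp add: \<sigma>_def)
  qed
  ultimately show "\<exists>\<sigma>. monomial_related \<sigma> (\<lambda>_. 1) X X'"
    by (auto simp: monomial_related_def)
next
  assume "\<exists>\<sigma>. monomial_related \<sigma> (\<lambda>_. 1) X X'"
  then obtain \<sigma> where "bij \<sigma>" "\<And>i. column i X' = column (\<sigma> i) X"
    by (auto simp: monomial_related_def)
  then show "columns X = columns X'"
    unfolding columns_range using image_comp[of "\<lambda>i. column i X" \<sigma> UNIV]
    by (simp add: bij_is_surj comp_def)
qed

lemma scaling_equiv_columns_iff:
  assumes "invertible (X :: real^'n::finite^'n)" "invertible X'"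
  shows "(columns X, columns X') \<in> scaling_equiv \<longleftrightarrow> (\<exists>\<sigma> l. monomial_related \<sigma> l X X')"
proof
  let ?c = "\<lambda>i. column i X" and ?c' = "\<lambda>i. column i X'"
  have b: "bij_betw ?c UNIV (columns X)" "bij_betw ?c' UNIV (columns X')"
    using inj_column[OF assms(1)] inj_column[OF assms(2)] columns_range
    by (auto simp: bij_betw_def)
  {
    assume "(columns X, columns X') \<in> scaling_equiv"
    then obtain u v :: "'n \<Rightarrow> real^'n" and \<tau> l where
      uv: "bij_betw u UNIV (columns X)" "bij_betw v UNIV (columns X')" "\<tau> permutes UNIV"
      and l: "\<And>i. l i > 0" "\<And>i. v (\<tau> i) = l i *\<^sub>R u i"
      unfolding scaling_equiv_def by blast
    define a where "a = inv_into UNIV v \<circ> ?c'"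
    define b' where "b' = inv_into UNIV ?c \<circ> u"
    have a: "bij a" unfolding a_def using bij_betw_trans[OF b(2) bij_betw_inv_into[OF uv(2)]] .
    have b': "bij b'" unfolding b'_def using bij_betw_trans[OF uv(1) bij_betw_inv_into[OF b(1)]] .
    have va: "v (a i) = ?c' i" for i
      using bij_betw_apply[OF b(2), of i] uv(2) by (simp add: a_def bij_betw_def f_inv_into_f)
    have cb: "?c (b' i) = u i" for i
      using bij_betw_apply[OF uv(1), of i] f_inv_into_f[of "u i" ?c UNIV] by (simp add: b'_def columns_range)
    have \<tau>: "bij \<tau>" using uv(3) by (rule permutes_bij)
    define \<sigma> where "\<sigma> = b' \<circ> (inv \<tau> \<circ> a)"
    have "?c' i = l (inv \<tau> (a i)) *\<^sub>R ?c (\<sigma> i)" for i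
      using l(2)[of "inv \<tau> (a i)"] permutes_inverses(1)[OF uv(3)]
      by (simp add: \<sigma>_def va cb)
    moreover have "bij \<sigma>" unfolding \<sigma>_def using a b' \<tau> by (intro bij_comp bij_imp_bij_inv)
    ultimately have "monomial_related \<sigma> (\<lambda>i. l (inv \<tau> (a i))) X X'"
      using l(1) by (simp add: monomial_related_def)
    then show "\<exists>\<sigma> l. monomial_related \<sigma> l X X'" by blast
  }
  assume "\<exists>\<sigma> l. monomial_related \<sigma> l X X'"
  then obtain \<sigma> l where \<sigma>: "bij \<sigma>" and l: "\<And>i. l i > 0" "\<And>i. ?c' i = l i *\<^sub>R ?c (\<sigma> i)"
    by (auto simp: monomial_related_def)
  have "bij_betw (?c \<circ> \<sigma>) UNIV (columns X)" using bij_betw_trans[OF \<sigma> b(1)] .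
  then have "\<exists>(u :: 'n \<Rightarrow> real^'n) (v :: 'n \<Rightarrow> real^'n) \<sigma> l.
        bij_betw u UNIV (columns X) \<and> bij_betw v UNIV (columns X') \<and> \<sigma> permutes UNIV \<and>
        (\<forall>i. l i > 0 \<and> v (\<sigma> i) = l i *\<^sub>R u i)"
    using b(2) l permutes_id by (intro exI[of _ "?c \<circ> \<sigma>"] exI[of _ ?c'] exI[of _ id] exI[of _ l]) auto
  then show "(columns X, columns X') \<in> scaling_equiv"
    using assms by (simp add: scaling_equiv_def is_basis_columns)
qed

lemma G_cone_subset:
  assumes "monomial_related \<sigma> l X (X' :: real^'n::finite^'n)"
  shows "G_cone X' \<subseteq> G_cone X"
proof
  fix v assume "v \<in> G_cone X'"
  then obtain m where m: "\<And>i. m i \<ge> 0" and v: "v = (\<Sum>i\<in>UNIV. m i *\<^sub>R column i X')"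
    by (auto simp: G_cone_def)
  have \<sigma>: "bij \<sigma>" and l: "l i > 0" and c: "column i X' = l i *\<^sub>R column (\<sigma> i) X" for i
    using assms by (auto simp: monomial_related_def)
  define m' where "m' = (\<lambda>j. m (inv \<sigma> j) * l (inv \<sigma> j))"
  have "v = (\<Sum>i\<in>UNIV. m' (\<sigma> i) *\<^sub>R column (\<sigma> i) X)"
    using \<sigma> by (simp add: v c m'_def bij_is_inj)
  also have "\<dots> = (\<Sum>j\<in>UNIV. m' j *\<^sub>R column j X)"
    using sum.reindex_bij_betw[OF \<sigma>, of "\<lambda>j. m' j *\<^sub>R column j X"] .
  finally have "v = (\<Sum>j\<in>UNIV. m' j *\<^sub>R column j X)" .
  moreover have "m' j \<ge> 0" for j using m l by (simp add: m'_def less_imp_le)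
  ultimately show "v \<in> G_cone X" unfolding G_cone_def by blast
qed

text \<open>If \<open>Q P = 1\<close> with nonnegative entries, nothing can cancel in an off-diagonal entry of \<open>Q P\<close>, so
  each of its summands vanishes. A positive entry in column \<open>i\<close> of \<open>P\<close> therefore kills all but one
  entry of the corresponding column of \<open>Q\<close>, and the same column of \<open>P Q = 1\<close> then leaves only that
  entry in column \<open>i\<close> of \<open>P\<close>.\<close>

lemma nonneg_inverse_pair_monomial:
  fixes P Q :: "real^'n::finite^'n"
  assumes PQ: "P ** Q = mat 1" and P: "\<And>i j. P $ i $ j \<ge> 0" and Q: "\<And>i j. Q $ i $ j \<ge> 0"
  obtains \<sigma> where "bij \<sigma>" "\<And>i. P $ \<sigma> i $ i > 0" "\<And>i m. m \<noteq> \<sigma> i \<Longrightarrow> P $ m $ i = 0"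
proof -
  have QP: "Q ** P = mat 1" using PQ matrix_left_right_inverse by blast
  have z: "Q $ j $ m * P $ m $ i = 0" if "j \<noteq> i" for i j m
  proof -
    have "(Q ** P) $ j $ i = 0" using QP that by (simp add: mat_def)
    then have "(\<Sum>m\<in>UNIV. Q $ j $ m * P $ m $ i) = 0" by (simp add: matrix_matrix_mult_def)
    then show ?thesis using P Q by (simp add: sum_nonneg_eq_0_iff)
  qed
  have "\<exists>m. P $ m $ i > 0" for i
  proof (rule ccontr)
    assume "\<not> ?thesis"
    then have "P $ m $ i = 0" for m using P[of m i] by (metis order_le_less)
    then have "(Q ** P) $ i $ i = 0" by (simp add: matrix_matrix_mult_def)
    then show False using QP by (simp add: mat_def)
  qed
  then obtain \<sigma> where \<sigma>: "\<And>i. P $ \<sigma> i $ i > 0" by metis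
  have Q0: "Q $ j $ \<sigma> i = 0" if "j \<noteq> i" for i j
    using z[OF that, of "\<sigma> i"] \<sigma>[of i] by simp
  have PQ1: "P $ m $ i * Q $ i $ \<sigma> i = (if m = \<sigma> i then 1 else 0)" for m i
  proof -
    have "(P ** Q) $ m $ \<sigma> i = (\<Sum>j\<in>UNIV. if j = i then P $ m $ i * Q $ i $ \<sigma> i else 0)"
      unfolding matrix_matrix_mult_def vec_lambda_beta by (intro sum.cong) (auto simp: Q0)
    then show ?thesis using PQ by (simp add: mat_def)
  qed
  have Qi: "Q $ i $ \<sigma> i \<noteq> 0" for i using PQ1[of "\<sigma> i" i] by auto
  have "inj \<sigma>" using Q0 Qi by (metis injI)
  then have "bij \<sigma>" by (simp add: bij_def finite_UNIV_inj_surj)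
  moreover have "P $ m $ i = 0" if "m \<noteq> \<sigma> i" for m i using PQ1[of m i] Qi that by simp
  ultimately show thesis using that \<sigma> by blast
qed

lemma columns_in_G_cone:
  assumes "\<And>i. column i X' \<in> G_cone (X :: real^'n::finite^'n)"
  obtains P where "X' = X ** P" "\<And>i j. P $ i $ j \<ge> 0"
proof -
  have "\<forall>i. \<exists>l. column i X' = (\<Sum>j\<in>UNIV. l j *\<^sub>R column j X) \<and> (\<forall>j. l j \<ge> 0)"
    using assms by (auto simp: G_cone_def)
  then obtain l where l: "\<And>i. column i X' = (\<Sum>j\<in>UNIV. l i j *\<^sub>R column j X)" "\<And>i j. l i j \<ge> 0"
    by metis
  define P where "P = (\<chi> j i. l i j)"
  have "X' $ r $ i = (X ** P) $ r $ i" for r i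
  proof -
    have "X' $ r $ i = column i X' $ r" by (simp add: column_def)
    also have "\<dots> = (\<Sum>j\<in>UNIV. l i j * X $ r $ j)"
      by (simp only: l(1)) (simp add: column_def)
    finally show ?thesis by (simp add: matrix_matrix_mult_def P_def mult.commute)
  qed
  then have "X' = X ** P" by (simp add: vec_eq_iff)
  then show thesis using that[of P] l(2) by (simp add: P_def)
qed

lemma column_in_G_cone: "column i X \<in> G_cone (X :: real^'n::finite^'n)"
proof -
  have "column i X = (\<Sum>j\<in>UNIV. (if j = i then 1 else 0) *\<^sub>R column j X)"
    by (simp add: if_distrib[where f = "\<lambda>a. a *\<^sub>R _"] cong: if_cong)
  then show ?thesis unfolding G_cone_def by force
qed

text \<open>Equal cones express each basis with nonnegative coefficients in the other. The two coefficient
  matrices are inverse to each other, hence monomial.\<close>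

lemma G_cone_eq_iff:
  assumes "invertible (X :: real^'n::finite^'n)" "invertible X'"
  shows "G_cone X = G_cone X' \<longleftrightarrow> (\<exists>\<sigma> l. monomial_related \<sigma> l X X')"
proof
  assume eq: "G_cone X = G_cone X'"
  obtain P where P: "X' = X ** P" "\<And>i j. P $ i $ j \<ge> 0"
    using columns_in_G_cone[of X' X] column_in_G_cone[of _ X'] eq by blast
  obtain Q where Q: "X = X' ** Q" "\<And>i j. Q $ i $ j \<ge> 0"
    using columns_in_G_cone[of X X'] column_in_G_cone[of _ X] eq by blast
  obtain L where L: "L ** X = mat 1" using assms(1) by (auto simp: invertible_def)
  have "X ** (P ** Q) = X" using P(1) Q(1) by (simp add: matrix_mul_assoc)
  then have "L ** X ** (P ** Q) = L ** X" by (metis matrix_mul_assoc)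
  then have "P ** Q = mat 1" by (simp add: L)
  then obtain \<sigma> where \<sigma>: "bij \<sigma>" "\<And>i. P $ \<sigma> i $ i > 0" "\<And>i m. m \<noteq> \<sigma> i \<Longrightarrow> P $ m $ i = 0"
    using nonneg_inverse_pair_monomial[OF _ P(2) Q(2)] by blast
  have "column i X' = P $ \<sigma> i $ i *\<^sub>R column (\<sigma> i) X" for i
  proof -
    have "X' $ r $ i = (\<Sum>m\<in>UNIV. if m = \<sigma> i then X $ r $ m * P $ m $ i else 0)" for r
      unfolding P(1) matrix_matrix_mult_def vec_lambda_beta using \<sigma>(3) by (intro sum.cong) auto
    then show ?thesis by (simp add: vec_eq_iff column_def)
  qed
  then show "\<exists>\<sigma> l. monomial_related \<sigma> l X X'"
    using \<sigma> unfolding monomial_related_def by (intro exI[of _ \<sigma>] exI[of _ "\<lambda>i. P $ \<sigma> i $ i"]) auto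
next
  assume "\<exists>\<sigma> l. monomial_related \<sigma> l X X'"
  then show "G_cone X = G_cone X'"
    using G_cone_subset monomial_related_sym by blast
qed

lemma column_mult_diag_inv_sqrt:
  "column i (X ** diag_inv_sqrt d) = inverse (sqrt (d $ i)) *\<^sub>R column i (X :: real^'n::finite^'n)"
proof -
  have "X $ r $ m * diag_inv_sqrt d $ m $ i = (if m = i then X $ r $ i * inverse (sqrt (d $ i)) else 0)" for r m
    by (simp add: diag_inv_sqrt_def diag_mat_def)
  then show ?thesis by (simp add: vec_eq_iff column_def matrix_matrix_mult_def)
qed

lemma invertible_mult_diag_inv_sqrt:
  assumes "invertible (X :: real^'n::finite^'n)" "\<And>i. d $ i > 0"
  shows "invertible (X ** diag_inv_sqrt d)"
proof -
  have nz: "sqrt (d $ i) \<noteq> 0" for i using assms(2)[of i] by simp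
  have "diag_inv_sqrt d ** diag_mat (\<chi> i. sqrt (d $ i)) = mat 1"
    unfolding diag_inv_sqrt_def diag_mat_def mat_def matrix_matrix_mult_def
    using nz by (simp add: vec_eq_iff if_distrib[where f = "\<lambda>a. a * _"] cong: if_cong)
  then have "invertible (diag_inv_sqrt d)"
    using invertible_right_inverse by blast
  then show ?thesis using assms(1) by (intro invertible_mult)
qed

lemma columns_diag_inv_sqrt_eq_iff:
  assumes "invertible (X :: real^'n::finite^'n)" "invertible X'" and d: "\<And>i. d $ i > 0"
  shows "columns (X ** diag_inv_sqrt d) = columns (X' ** diag_inv_sqrt d) \<longleftrightarrow>
    (\<exists>\<sigma>. monomial_related \<sigma> (\<lambda>i. sqrt (d $ i / d $ \<sigma> i)) X X')"
proof -
  have "inverse (sqrt (d $ i)) *\<^sub>R u = inverse (sqrt (d $ j)) *\<^sub>R v \<longleftrightarrow>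
      u = sqrt (d $ i / d $ j) *\<^sub>R v" for i j and u v :: "real^'n"
    using d[of i] d[of j] by (simp add: real_sqrt_divide vec_eq_iff field_simps)
  then show ?thesis
    using d by (simp add: columns_eq_iff assms invertible_mult_diag_inv_sqrt monomial_related_def
        column_mult_diag_inv_sqrt)
qed


section \<open>Dual bases\<close>

text \<open>In matrix form this reads \<open>Y\<^sup>T D X = D\<close> with \<open>D = diag d\<close>: up to the lengths \<open>d p\<close>, the columns of
  \<open>Y\<close> are dual to those of \<open>X\<close> for the scalar product weighted by \<open>d\<close>.\<close>

definition dual_bases :: "real^'n::finite \<Rightarrow> real^'n^'n \<Rightarrow> real^'n^'n \<Rightarrow> bool" where
  "dual_bases d X Y \<longleftrightarrow>
     (\<forall>p q. (\<Sum>i\<in>UNIV. d $ i * X $ i $ q * Y $ i $ p) = (if p = q then d $ p else 0))"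

lemma dual_bases_sym:
  assumes "dual_bases d X Y"
  shows "dual_bases d Y X"
proof -
  have "(\<Sum>i\<in>UNIV. d $ i * Y $ i $ q * X $ i $ p) = (\<Sum>i\<in>UNIV. d $ i * X $ i $ p * Y $ i $ q)" for p q
    by (intro sum.cong) auto
  then show ?thesis using assms by (simp add: dual_bases_def)
qed

lemma dual_bases_inverse:
  assumes "dual_bases d X Y" and d: "\<And>i. d $ i > 0"
  shows "(\<chi> p i. d $ i * Y $ i $ p / d $ p) ** X = mat 1"
proof -
  have "(\<Sum>i\<in>UNIV. d $ i * Y $ i $ p / d $ p * X $ i $ q) = (if p = q then 1 else 0)" for p q
  proof -
    have "(\<Sum>i\<in>UNIV. d $ i * Y $ i $ p / d $ p * X $ i $ q) =
        (\<Sum>i\<in>UNIV. d $ i * X $ i $ q * Y $ i $ p) / d $ p"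
      unfolding sum_divide_distrib by (intro sum.cong) auto
    then show ?thesis using assms(1) d[of q] by (simp add: dual_bases_def)
  qed
  then show ?thesis by (simp add: vec_eq_iff matrix_matrix_mult_def mat_def)
qed

lemma dual_bases_invertible:
  assumes "dual_bases d X Y" and "\<And>i. d $ i > 0"
  shows "invertible X" "invertible Y"
  using dual_bases_inverse[OF assms] dual_bases_inverse[OF dual_bases_sym[OF assms(1)] assms(2)]
    invertible_left_inverse by blast+

text \<open>This is an off-diagonal entry of \<open>X D\<^sup>-\<^sup>1 Y\<^sup>T = D\<^sup>-\<^sup>1\<close>, which holds because a left inverse of a
  square matrix is also a right inverse.\<close>

lemma dual_bases_rows:
  assumes "dual_bases d X Y" and d: "\<And>i. d $ i > 0" and "i \<noteq> k"
  shows "(\<Sum>q\<in>UNIV. X $ i $ q * Y $ k $ q / d $ q) = 0"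
proof -
  have "X ** (\<chi> p i. d $ i * Y $ i $ p / d $ p) = mat 1"
    using dual_bases_inverse[OF assms(1,2)] matrix_left_right_inverse by blast
  then have "(X ** (\<chi> p i. d $ i * Y $ i $ p / d $ p)) $ i $ k = 0"
    using assms(3) by (simp add: mat_def)
  then have "(\<Sum>q\<in>UNIV. X $ i $ q * (d $ k * Y $ k $ q / d $ q)) = 0"
    by (simp add: matrix_matrix_mult_def)
  then have "d $ k * (\<Sum>q\<in>UNIV. X $ i $ q * Y $ k $ q / d $ q) = 0"
    by (simp add: sum_distrib_left mult.commute mult.left_commute)
  then show ?thesis using d[of k] by simp
qed

lemma dual_bases_unique:
  assumes "dual_bases d X Y" "dual_bases d X Y'" and d: "\<And>i. d $ i > 0"
  shows "Y = Y'"
proof -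
  let ?L = "\<lambda>Y. \<chi> p i. d $ i * Y $ i $ p / d $ p"
  have "?L Y ** X = mat 1" "?L Y' ** X = mat 1"
    using dual_bases_inverse assms by blast+
  moreover obtain R where "X ** R = mat 1"
    using calculation(1) matrix_left_right_inverse by blast
  ultimately have eq: "?L Y = ?L Y'"
    by (metis (lifting) matrix_mul_assoc matrix_mul_lid matrix_mul_rid)
  have "d $ i * Y $ i $ p / d $ p = d $ i * Y' $ i $ p / d $ p" for i p
    using arg_cong[OF eq, of "\<lambda>M. M $ p $ i"] by (simp only: vec_lambda_beta)
  moreover have "d $ i \<noteq> 0" for i using d[of i] by simp
  ultimately show ?thesis by (simp add: vec_eq_iff)
qed

text \<open>Rescaling a basis vector by \<open>l\<close> rescales its dual vector by \<open>1 / l\<close>; the extra factor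
  \<open>d i / d (\<sigma> i)\<close> comes from the normalisation of the dual basis, whose lengths are attached to the
  position \<open>i\<close> and not to the vector.\<close>

lemma monomial_related_dual:
  assumes "dual_bases d X Y" "dual_bases d X' Y'" and d: "\<And>i. d $ i > 0"
    and "monomial_related \<sigma> l X X'"
  shows "monomial_related \<sigma> (\<lambda>i. d $ i / (d $ \<sigma> i * l i)) Y Y'"
proof -
  have \<sigma>: "bij \<sigma>" and l: "l i > 0" and c: "column i X' = l i *\<^sub>R column (\<sigma> i) X" for i
    using assms(4) by (auto simp: monomial_related_def)
  have X': "X' $ r $ q = l q * X $ r $ \<sigma> q" for r q
    using c[of q] by (simp add: vec_eq_iff column_def)
  define Z where "Z = (\<chi> r p. d $ p / (d $ \<sigma> p * l p) * Y $ r $ \<sigma> p)"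
  have "(\<Sum>i\<in>UNIV. d $ i * X' $ i $ q * Z $ i $ p) = (if p = q then d $ p else 0)" for p q
  proof -
    have "(\<Sum>i\<in>UNIV. d $ i * X' $ i $ q * Z $ i $ p) =
        l q * (d $ p / (d $ \<sigma> p * l p)) * (\<Sum>i\<in>UNIV. d $ i * X $ i $ \<sigma> q * Y $ i $ \<sigma> p)"
      unfolding sum_distrib_left by (intro sum.cong) (auto simp: X' Z_def)
    also have "(\<Sum>i\<in>UNIV. d $ i * X $ i $ \<sigma> q * Y $ i $ \<sigma> p) = (if p = q then d $ \<sigma> p else 0)"
      using assms(1) \<sigma> by (simp add: dual_bases_def bij_is_inj inj_eq)
    finally show ?thesis using l[of p] l[of q] d[of "\<sigma> p"] by auto
  qed
  then have "dual_bases d X' Z" by (simp add: dual_bases_def)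
  then have "Y' = Z" using dual_bases_unique assms(2) d by blast
  then show ?thesis
    using \<sigma> l d by (simp add: monomial_related_def column_def Z_def vec_eq_iff)
qed


section \<open>Patterns along arbitrary words\<close>

text \<open>The recursions make sense for words with repeated consecutive letters too, and inverse steps
  cancel, so a word and its reduction yield the same matrices. Working with arbitrary words makes
  moving the initial vertex a mere appending of a letter, without reducing the result.\<close>

lemma reduced_word:
  assumes "skew_symmetrizable B"
  shows "\<exists>t \<in> tree_vertices. B_pattern B t = B_pattern B w \<and> C_pattern B t = C_pattern B w \<and>
    G_pattern B t = G_pattern B w"
proof (induction w)
  case Nil
  then show ?case by (intro bexI[of _ "[]"]) (auto simp: tree_vertices_def)
next
  case (Cons k w)
  then obtain t where t: "t \<in> tree_vertices" "B_pattern B t = B_pattern B w"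
    "C_pattern B t = C_pattern B w" "G_pattern B t = G_pattern B w" by blast
  obtain t' where t': "k_adjacent k t t'" using tree_regular[OF t(1)] by blast
  have "B_pattern B t' = B_pattern B (k # w)" "C_pattern B t' = C_pattern B (k # w)"
    "G_pattern B t' = G_pattern B (k # w)"
    using B_pattern_adjacent[OF assms t'] C_pattern_adjacent[OF assms t']
      G_pattern_adjacent[OF assms t'] t by simp_all
  moreover have "t' \<in> tree_vertices" using t' by (simp add: k_adjacent_def)
  ultimately show ?case by blast
qed

lemma B_pattern_mutation: "B_pattern (mutation k B) w = B_pattern B (w @ [k])"
  by (induction w) auto

lemma hypothesis_H_mutation:
  assumes "hypothesis_H B" "skew_symmetrizable B"
  shows "hypothesis_H (mutation k B)"
  unfolding hypothesis_H_def
proof (intro allI impI)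
  fix B' assume "mutation_equivalent (mutation k B) B'"
  then obtain t where "B' = B_pattern B (t @ [k])"
    by (auto simp: mutation_equivalent_def B_pattern_mutation)
  then obtain t' where "t' \<in> tree_vertices" "B' = B_pattern B t'"
    using reduced_word[OF assms(2), of "t @ [k]"] by auto
  then show "sign_coherent B' \<and> discrete B'"
    using assms(1) by (auto simp: hypothesis_H_def mutation_equivalent_def)
qed

lemma hypothesis_H_self:
  assumes "hypothesis_H B"
  shows "sign_coherent B" "discrete B"
proof -
  have "mutation_equivalent B B"
    unfolding mutation_equivalent_def by (intro bexI[of _ "[]"]) (auto simp: tree_vertices_def)
  then show "sign_coherent B" "discrete B" using assms by (auto simp: hypothesis_H_def)
qed

text \<open>The first step away from the initial vertex is the last letter of a word; a step and its inverse
  taken there bring all matrices back to their initial values.\<close>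

lemma pattern_cancel_initial:
  assumes "skew_symmetrizable B"
  shows "B_pattern B (w @ [k, k]) = B_pattern B w" "C_pattern B (w @ [k, k]) = C_pattern B w"
proof -
  have adj: "k_adjacent k [k] []" by (simp add: k_adjacent_def tree_vertices_def)
  have "B_pattern B (w @ [k, k]) = B_pattern B w \<and> C_pattern B (w @ [k, k]) = C_pattern B w"
  proof (induction w)
    case Nil
    show ?case
      using B_pattern_adjacent[OF assms adj] C_pattern_adjacent[OF assms adj] by simp
  qed auto
  then show "B_pattern B (w @ [k, k]) = B_pattern B w" "C_pattern B (w @ [k, k]) = C_pattern B w"
    by blast+
qed

lemma sign_coherent_word:
  assumes "skew_symmetrizable B" "sign_coherent B"
  shows "sign_coherent_vec (column i (C_pattern B w))" "sign_coherent_vec (row i (G_pattern B w))"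
proof -
  obtain t where "t \<in> tree_vertices" "C_pattern B t = C_pattern B w" "G_pattern B t = G_pattern B w"
    using reduced_word[OF assms(1), of w] by blast
  then show "sign_coherent_vec (column i (C_pattern B w))" "sign_coherent_vec (row i (G_pattern B w))"
    using assms(2) unfolding sign_coherent_def by metis+
qed

lemma discrete_word:
  assumes "skew_symmetrizer d B" "discrete B" "column i (C_pattern B w) = \<alpha> *\<^sub>R axis j 1"
  shows "\<bar>\<alpha>\<bar> = sqrt (d $ i / d $ j)"
proof -
  have "skew_symmetrizable B" using assms(1) by (auto simp: skew_symmetrizable_def)
  then obtain t where t: "t \<in> tree_vertices" "C_pattern B t = C_pattern B w"
    using reduced_word[of B w] by blast
  have "column i (C_pattern B t) = \<alpha> *\<^sub>R axis j 1" using assms(3) t by simp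
  then have "\<alpha> = sqrt (d $ i / d $ j) \<or> \<alpha> = - sqrt (d $ i / d $ j)"
    using assms(1,2) t(1) unfolding discrete_def by blast
  moreover have "d $ i > 0" "d $ j > 0" using assms(1) unfolding skew_symmetrizer_entry by blast+
  ultimately show ?thesis by auto
qed


section \<open>Signs and the duality of C- and G-matrices\<close>

definition has_sign :: "real \<Rightarrow> ('n \<Rightarrow> real) \<Rightarrow> bool" where
  "has_sign \<epsilon> f \<longleftrightarrow> (\<epsilon> = 1 \<or> \<epsilon> = -1) \<and> (\<forall>i. 0 \<le> \<epsilon> * f i)"

lemma sign_coherent_vec_has_sign:
  "sign_coherent_vec v \<Longrightarrow> \<exists>\<epsilon>. has_sign \<epsilon> (\<lambda>i. v $ i)"
  unfolding sign_coherent_vec_def has_sign_def by force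

lemma has_sign_unique:
  assumes "has_sign \<epsilon> f" "has_sign \<epsilon>' g" "f i = g i" "f i \<noteq> 0"
  shows "\<epsilon> = \<epsilon>'"
proof -
  have "0 \<le> \<epsilon> * f i" "0 \<le> \<epsilon>' * g i" "\<epsilon> = 1 \<or> \<epsilon> = -1" "\<epsilon>' = 1 \<or> \<epsilon>' = -1"
    using assms(1,2) by (simp_all add: has_sign_def)
  then show ?thesis using assms(3,4) by auto
qed

lemma has_sign_flip:
  assumes "has_sign \<epsilon> f" "has_sign \<epsilon>' g" "f i = - g i" "f i \<noteq> 0"
  shows "\<epsilon>' = - \<epsilon>"
proof -
  have "0 \<le> \<epsilon> * f i" "0 \<le> \<epsilon>' * g i" "\<epsilon> = 1 \<or> \<epsilon> = -1" "\<epsilon>' = 1 \<or> \<epsilon>' = -1"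
    using assms(1,2) by (simp_all add: has_sign_def)
  then show ?thesis using assms(3,4) by auto
qed

text \<open>With \<open>\<epsilon>\<close> the sign of column \<open>k\<close> of \<open>C\<close>, right multiplication by this matrix is mutation of \<open>C\<close> in
  direction \<open>k\<close>. The same matrices, multiplied from the left, describe a change of the initial
  vertex.\<close>

definition signed_step :: "real \<Rightarrow> 'n \<Rightarrow> real^'n^'n \<Rightarrow> real^'n^'n" where
  "signed_step \<epsilon> k A = J_mat k + row_part k (pos_mat (\<epsilon> *\<^sub>R A))"

lemma mult_signed_step:
  "A $ k $ k = 0 \<Longrightarrow> (X ** signed_step \<epsilon> k A) $ i $ j =
     (if j = k then - X $ i $ k else X $ i $ j + X $ i $ k * max (\<epsilon> * A $ k $ j) 0)"
  by (simp add: signed_step_def matrix_add_ldistrib mult_J row_part_mult pos_mat_def)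

lemma signed_step_entry:
  "A $ k $ k = 0 \<Longrightarrow> signed_step \<epsilon> k A $ i $ j =
     (if i = k then if j = k then - 1 else max (\<epsilon> * A $ k $ j) 0 else if i = j then 1 else 0)"
  by (auto simp: signed_step_def J_mat_def row_part_def pos_mat_def)

lemma row_part_mult_left:
  "(row_part k M ** X) $ i $ j = (if i = k then \<Sum>m\<in>UNIV. M $ k $ m * X $ m $ j else 0)"
  by (simp add: matrix_matrix_mult_def row_part_def)

lemma signed_step_mult:
  "A $ k $ k = 0 \<Longrightarrow> (signed_step \<epsilon> k A ** X) $ i $ j =
     (if i = k then - X $ k $ j + (\<Sum>m\<in>UNIV. max (\<epsilon> * A $ k $ m) 0 * X $ m $ j) else X $ i $ j)"
  by (simp add: signed_step_def matrix_add_right_distrib J_mult row_part_mult_left pos_mat_def)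

lemma signed_step_involution:
  assumes "A $ k $ k = 0"
  shows "signed_step \<epsilon> k A ** signed_step \<epsilon> k A = mat 1"
  using assms by (auto simp: vec_eq_iff mult_signed_step signed_step_entry mat_def)

lemma signed_step_opposite:
  assumes "A $ k $ k = 0" "\<epsilon> = 1 \<or> \<epsilon> = -1"
  shows "signed_step (- \<epsilon>) k A ** signed_step \<epsilon> k A = mat 1 - \<epsilon> *\<^sub>R row_part k A"
  using assms by (auto simp: vec_eq_iff mult_signed_step signed_step_entry mat_def row_part_def max_neg)

text \<open>For a nonnegative column \<open>k\<close> the term with \<open>[-C]\<^sub>+\<close> vanishes; for a nonpositive one it is \<open>- C B\<^sub>t\<close>
  restricted to that column, and \<open>[x]\<^sub>+ - x = [-x]\<^sub>+\<close> merges it with the other correction term.\<close>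

lemma C_pattern_signed:
  assumes "skew_symmetrizable B" "has_sign \<epsilon> (\<lambda>i. C_pattern B w $ i $ k)"
  shows "C_pattern B (k # w) = C_pattern B w ** signed_step \<epsilon> k (B_pattern B w)"
proof -
  have z: "B_pattern B w $ k $ k = 0"
    using assms skew_symmetrizer_diag skew_symmetrizer_B_pattern
    unfolding skew_symmetrizable_def by blast
  have "C_pattern B (k # w) $ i $ j = (C_pattern B w ** signed_step \<epsilon> k (B_pattern B w)) $ i $ j" for i j
  proof -
    have "0 \<le> \<epsilon> * C_pattern B w $ i $ k" "\<epsilon> = 1 \<or> \<epsilon> = -1"
      using assms(2) by (auto simp: has_sign_def)
    then show ?thesis
      unfolding mult_signed_step[where A = "B_pattern B w", OF z] C_pattern.simps C_entry[OF z]
      by (auto simp: max_neg max_absorb1 max_absorb2 algebra_simps)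
  qed
  then show ?thesis by (simp add: vec_eq_iff)
qed

text \<open>For a negative c-vector the term \<open>B [-C]\<^sub>+\<close> equals \<open>- B C\<close> in column \<open>k\<close>, and the identity
  \<open>G\<^sub>t B\<^sub>t = B C\<^sub>t\<close> turns it into a term in \<open>G\<^sub>t\<close> and \<open>B\<^sub>t\<close> alone.\<close>

lemma G_pattern_signed:
  assumes "skew_symmetrizable B" "has_sign \<epsilon> (\<lambda>i. C_pattern B w $ i $ k)"
  shows "G_pattern B (k # w) $ i $ j =
    (if j = k then - G_pattern B w $ i $ k
         + (\<Sum>l\<in>UNIV. G_pattern B w $ i $ l * max (- \<epsilon> * B_pattern B w $ l $ k) 0)
     else G_pattern B w $ i $ j)"
proof -
  have gb: "(\<Sum>l\<in>UNIV. G_pattern B w $ i $ l * B_pattern B w $ l $ k) =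
      (\<Sum>l\<in>UNIV. B $ i $ l * C_pattern B w $ l $ k)"
    using GB_eq_BC[OF assms(1), of w] by (simp add: matrix_matrix_mult_def vec_eq_iff)
  have s: "\<epsilon> = 1 \<and> (\<forall>l. 0 \<le> C_pattern B w $ l $ k) \<or> \<epsilon> = -1 \<and> (\<forall>l. C_pattern B w $ l $ k \<le> 0)"
    using assms(2) by (auto simp: has_sign_def)
  show ?thesis
    unfolding G_pattern.simps G_entry using s gb
    by (auto simp: max_absorb1 max_absorb2 max_neg right_diff_distrib sum_subtractf sum_negf)
qed

text \<open>With signs, mutation changes \<open>C\<close> by adding multiples of \<open>c\<^sub>k\<close> to the other c-vectors, and \<open>G\<close> by
  replacing only \<open>g\<^sub>k\<close>. Pairing the new vectors leaves a single nontrivial identity, between the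
  coefficients \<open>m\<close> and \<open>n\<close> of the two rules, which is the skew-symmetry of \<open>D B\<^sub>t\<close>.\<close>

lemma dual_bases_patterns:
  assumes d: "skew_symmetrizer d B" and "sign_coherent B"
  shows "dual_bases d (C_pattern B w) (G_pattern B w)"
proof (induction w)
  case Nil
  have "(\<Sum>i\<in>UNIV. d $ i * mat 1 $ i $ q * mat 1 $ i $ p) = (\<Sum>i\<in>UNIV. if i = q then (if p = q then d $ p else 0) else 0)" for p q
    by (intro sum.cong) (auto simp: mat_def)
  then show ?case by (simp add: dual_bases_def)
next
  case (Cons k w)
  define C G A where "C = C_pattern B w" and "G = G_pattern B w" and "A = B_pattern B w"
  have sk: "skew_symmetrizable B" using d by (auto simp: skew_symmetrizable_def)
  have A: "skew_symmetrizer d A" unfolding A_def using d by (rule skew_symmetrizer_B_pattern)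
  have z: "A $ k $ k = 0" using A by (rule skew_symmetrizer_diag)
  obtain \<epsilon> where \<epsilon>: "has_sign \<epsilon> (\<lambda>i. C $ i $ k)"
    using sign_coherent_vec_has_sign[OF sign_coherent_word(1)[OF sk assms(2), of k w]]
    by (auto simp: column_def C_def)
  define m n where "m = (\<lambda>q. max (\<epsilon> * A $ k $ q) 0)" and "n = (\<lambda>l. max (- \<epsilon> * A $ l $ k) 0)"
  define S where "S = (\<lambda>p q. \<Sum>i\<in>UNIV. d $ i * C $ i $ q * G $ i $ p)"
  have S: "S p q = (if p = q then d $ p else 0)" for p q
    using Cons by (simp add: dual_bases_def S_def C_def G_def)
  have C': "C_pattern B (k # w) $ i $ q = (if q = k then - C $ i $ k else C $ i $ q + m q * C $ i $ k)" for i q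
    using C_pattern_signed[OF sk \<epsilon>[unfolded C_def]] mult_signed_step[of A k C \<epsilon> i q, OF z]
    by (simp add: C_def A_def m_def mult.commute)
  define h where "h = (\<lambda>i. \<Sum>l\<in>UNIV. n l * G $ i $ l)"
  have G': "G_pattern B (k # w) $ i $ p = (if p = k then - G $ i $ k + h i else G $ i $ p)" for i p
    using G_pattern_signed[OF sk \<epsilon>[unfolded C_def], of i p]
    by (simp add: G_def A_def n_def h_def mult.commute)
  have swap: "(\<Sum>i\<in>UNIV. d $ i * C $ i $ q * h i) = n q * d $ q" for q
  proof -
    have "(\<Sum>i\<in>UNIV. d $ i * C $ i $ q * h i) =
        (\<Sum>i\<in>UNIV. \<Sum>l\<in>UNIV. n l * (d $ i * C $ i $ q * G $ i $ l))"
      by (simp add: h_def sum_distrib_left mult_ac)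
    also have "\<dots> = (\<Sum>l\<in>UNIV. n l * S l q)"
      unfolding S_def sum_distrib_left by (rule sum.swap)
    also have "\<dots> = (\<Sum>l\<in>UNIV. if l = q then n q * d $ q else 0)"
      by (intro sum.cong) (auto simp: S)
    finally show ?thesis by simp
  qed
  \<comment> \<open>Skew-symmetry of \<open>D A\<close>, transferred to the positive parts because \<open>d\<close> is positive.\<close>
  have nm: "n q * d $ q = m q * d $ k" for q
  proof -
    have pos: "d $ q > 0" "d $ k > 0" and skew: "d $ q * A $ q $ k = - (d $ k * A $ k $ q)"
      using A unfolding skew_symmetrizer_entry by blast+
    have mx: "max x 0 * c = max (x * c) 0" if "c > 0" for c x :: real
      using that by (auto simp: max_def zero_le_mult_iff mult_le_0_iff)
    have "- \<epsilon> * A $ q $ k * d $ q = - \<epsilon> * (d $ q * A $ q $ k)" by simp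
    also have "\<dots> = \<epsilon> * A $ k $ q * d $ k" unfolding skew by simp
    finally show ?thesis unfolding n_def m_def mx[OF pos(1)] mx[OF pos(2)] by simp
  qed
  have nk: "n k = 0" by (simp add: n_def z)
  have "(\<Sum>i\<in>UNIV. d $ i * C_pattern B (k # w) $ i $ q * G_pattern B (k # w) $ i $ p) =
      (if p = q then d $ p else 0)" for p q
  proof -
    consider "p \<noteq> k" "q \<noteq> k" | "p \<noteq> k" "q = k" | "p = k" "q = k" | "p = k" "q \<noteq> k" by blast
    then show ?thesis
    proof cases
      case 1
      then have "(\<Sum>i\<in>UNIV. d $ i * C_pattern B (k # w) $ i $ q * G_pattern B (k # w) $ i $ p) =
         S p q + m q * S p k"
        unfolding C' G' S_def sum_distrib_left sum.distrib[symmetric]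
        by (intro sum.cong) (auto simp: algebra_simps)
      then show ?thesis using 1 by (simp add: S)
    next
      case 2
      then have "(\<Sum>i\<in>UNIV. d $ i * C_pattern B (k # w) $ i $ q * G_pattern B (k # w) $ i $ p) = - S p k"
        unfolding C' G' S_def by (simp add: sum_negf)
      then show ?thesis using 2 by (simp add: S)
    next
      case 3
      then have "(\<Sum>i\<in>UNIV. d $ i * C_pattern B (k # w) $ i $ q * G_pattern B (k # w) $ i $ p) =
          S k k - (\<Sum>i\<in>UNIV. d $ i * C $ i $ k * h i)"
        unfolding C' G' S_def sum_subtractf[symmetric]
        by (intro sum.cong) (auto simp: algebra_simps)
      then show ?thesis using 3 by (simp add: S swap nk)
    next
      case 4
      then have "(\<Sum>i\<in>UNIV. d $ i * C_pattern B (k # w) $ i $ q * G_pattern B (k # w) $ i $ p) =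
          (\<Sum>i\<in>UNIV. d $ i * C $ i $ q * h i) + m q * (\<Sum>i\<in>UNIV. d $ i * C $ i $ k * h i)
            - S k q - m q * S k k"
        unfolding C' G' S_def sum_distrib_left sum_subtractf[symmetric] sum.distrib[symmetric]
        by (intro sum.cong) (auto simp: algebra_simps)
      then show ?thesis using 4 by (simp add: S swap nk nm)
    qed
  qed
  then show ?case by (simp add: dual_bases_def)
qed


section \<open>Change of the initial vertex\<close>

text \<open>Duality already gives that a c-vector \<open>c\<^sub>l = \<alpha> e\<^sub>k\<close> forces row \<open>k\<close> of \<open>G\<close> to be \<open>\<beta> e\<^sub>l\<close> with
  \<open>\<alpha> \<beta> = d l / d k\<close>. Discreteness says \<open>\<alpha>\<^sup>2 = d l / d k\<close>, whence \<open>\<beta> = \<alpha>\<close>.\<close>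

lemma coordinate_c_vector:
  assumes d: "skew_symmetrizer d B" and "sign_coherent B" "discrete B"
    and c: "\<And>i. i \<noteq> k \<Longrightarrow> C_pattern B w $ i $ l = 0"
  shows "C_pattern B w $ k $ l \<noteq> 0" "G_pattern B w $ k $ l = C_pattern B w $ k $ l"
    "\<And>j. j \<noteq> l \<Longrightarrow> G_pattern B w $ k $ j = 0"
proof -
  define C G where "C = C_pattern B w" and "G = G_pattern B w"
  have pos: "d $ i > 0" for i using d unfolding skew_symmetrizer_entry by blast
  have S: "d $ k * C $ k $ l * G $ k $ p = (if p = l then d $ l else 0)" for p
  proof -
    have "(\<Sum>i\<in>UNIV. d $ i * C $ i $ l * G $ i $ p) = (\<Sum>i\<in>UNIV. if i = k then d $ k * C $ k $ l * G $ k $ p else 0)"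
      using c by (intro sum.cong) (auto simp: C_def)
    then show ?thesis
      using dual_bases_patterns[OF d assms(2), of w] by (auto simp: dual_bases_def C_def G_def)
  qed
  show nz: "C_pattern B w $ k $ l \<noteq> 0" using S[of l] pos[of l] by (auto simp: C_def)
  show "G_pattern B w $ k $ j = 0" if "j \<noteq> l" for j
    using S[of j] nz that pos[of k] by (auto simp: C_def G_def)
  have "column l C = C $ k $ l *\<^sub>R axis k 1"
    using c by (auto simp: vec_eq_iff column_def axis_def C_def)
  then have "\<bar>C $ k $ l\<bar> = sqrt (d $ l / d $ k)"
    using discrete_word[OF d assms(3)] by (simp add: C_def)
  then have "C $ k $ l * C $ k $ l = d $ l / d $ k"
    using pos[of k] pos[of l] by (metis abs_mult_self_eq divide_pos_pos less_imp_le real_sqrt_mult_self abs_of_nonneg)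
  then have "d $ k * C $ k $ l * C $ k $ l = d $ k * C $ k $ l * G $ k $ l"
    using S[of l] pos[of k] by (simp add: field_simps)
  then show "G_pattern B w $ k $ l = C_pattern B w $ k $ l"
    using nz pos[of k] by (simp add: C_def G_def)
qed

text \<open>The induction step mutates in direction \<open>l\<close>. Left multiplication by a signed step at \<open>k\<close> only
  alters the \<open>k\<close>-th entry of a c-vector. Hence the sign of \<open>c\<^sub>l\<close> is the same for both initial
  vertices unless \<open>c\<^sub>l\<close> is a multiple of \<open>e\<^sub>k\<close>, and by duality this is also the only case in which
  row \<open>k\<close> of \<open>G\<close> changes its sign. In that case \<open>c\<^sub>l\<close> has opposite signs for the two initial vertices
  while row \<open>k\<close> of \<open>G\<close> changes its sign under the mutation, and the claim for the new vertex becomes the identity \<open>B\<^sup>k C\<^sub>t = C\<^sub>t B\<^sub>t\<^sup>l\<close>, where the superscript keeps a single row. It holds because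
  row \<open>k\<close> of \<open>B C\<^sub>t = G\<^sub>t B\<^sub>t\<close> is \<open>\<beta>\<close> times row \<open>l\<close> of \<open>B\<^sub>t\<close>, with the same factor \<open>\<beta> = \<alpha>\<close> on both
  sides.\<close>

lemma C_pattern_change_initial:
  assumes d: "skew_symmetrizer d B" and H: "hypothesis_H B"
    and "has_sign \<eta> (\<lambda>j. G_pattern B w $ k $ j)"
  shows "C_pattern (mutation k B) (w @ [k]) = signed_step (- \<eta>) k B ** C_pattern B w"
  using assms(3)
proof (induction w arbitrary: \<eta>)
  case Nil
  then have "0 \<le> \<eta> * G_pattern B [] $ k $ k" "\<eta> = 1 \<or> \<eta> = -1"
    by (auto simp: has_sign_def)
  then have \<eta>: "\<eta> = 1" by (auto simp: mat_def)
  have z: "B $ k $ k = 0" using d by (rule skew_symmetrizer_diag)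
  then have z': "mutation k B $ k $ k = 0" by (simp add: mutation_entry)
  have "has_sign 1 (\<lambda>i. C_pattern (mutation k B) [] $ i $ k)"
    by (auto simp: has_sign_def mat_def)
  moreover have "skew_symmetrizable (mutation k B)"
    using d by (auto simp: skew_symmetrizable_def intro: skew_symmetrizer_mutation)
  ultimately have "C_pattern (mutation k B) [k] = signed_step 1 k (mutation k B)"
    using C_pattern_signed[of "mutation k B" 1 "[]" k] by simp
  also have "\<dots> = signed_step (- 1) k B"
    by (simp add: vec_eq_iff signed_step_entry z z' mutation_entry)
  finally show ?case by (simp add: \<eta>)
next
  case (Cons l w)
  define C G A C1 where "C = C_pattern B w" and "G = G_pattern B w" and "A = B_pattern B w"
    and "C1 = C_pattern (mutation k B) (w @ [k])"
  have sk: "skew_symmetrizable B" using d by (auto simp: skew_symmetrizable_def)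
  have sc: "sign_coherent B" and di: "discrete B" using hypothesis_H_self[OF H] .
  have d1: "skew_symmetrizer d (mutation k B)" using d by (rule skew_symmetrizer_mutation)
  then have sk1: "skew_symmetrizable (mutation k B)" by (auto simp: skew_symmetrizable_def)
  have sc1: "sign_coherent (mutation k B)"
    using hypothesis_H_self(1)[OF hypothesis_H_mutation[OF H sk]] .
  have z: "B $ k $ k = 0" using d by (rule skew_symmetrizer_diag)
  have zA: "A $ l $ l = 0"
    unfolding A_def using skew_symmetrizer_diag[OF skew_symmetrizer_B_pattern[OF d]] .
  have A1: "B_pattern (mutation k B) (w @ [k]) = A"
    using pattern_cancel_initial(1)[OF sk, of w k] by (simp add: B_pattern_mutation A_def)
  obtain \<epsilon> where \<epsilon>: "has_sign \<epsilon> (\<lambda>i. C $ i $ l)"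
    using sign_coherent_vec_has_sign[OF sign_coherent_word(1)[OF sk sc, of l w]]
    by (auto simp: column_def C_def)
  obtain \<epsilon>1 where \<epsilon>1: "has_sign \<epsilon>1 (\<lambda>i. C1 $ i $ l)"
    using sign_coherent_vec_has_sign[OF sign_coherent_word(1)[OF sk1 sc1, of l "w @ [k]"]]
    by (auto simp: column_def C1_def)
  obtain \<theta> where \<theta>: "has_sign \<theta> (\<lambda>j. G $ k $ j)"
    using sign_coherent_vec_has_sign[OF sign_coherent_word(2)[OF sk sc, of k w]]
    by (auto simp: row_def G_def)
  have IH: "C1 = signed_step (- \<theta>) k B ** C"
    using Cons.IH[OF \<theta>[unfolded G_def]] by (simp add: C1_def C_def)
  have C': "C_pattern B (l # w) = C ** signed_step \<epsilon> l A"
    using C_pattern_signed[OF sk \<epsilon>[unfolded C_def]] by (simp add: C_def A_def)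
  have C1': "C_pattern (mutation k B) ((l # w) @ [k]) = C1 ** signed_step \<epsilon>1 l A"
    using C_pattern_signed[OF sk1 \<epsilon>1[unfolded C1_def]] A1 by (simp add: C1_def)
  have G': "G_pattern B (l # w) $ k $ j =
      (if j = l then - G $ k $ l + (\<Sum>m\<in>UNIV. G $ k $ m * max (- \<epsilon> * A $ m $ l) 0) else G $ k $ j)" for j
    using G_pattern_signed[OF sk \<epsilon>[unfolded C_def]] by (simp add: G_def A_def)
  show ?case
  proof (cases "\<forall>i. i \<noteq> k \<longrightarrow> C $ i $ l = 0")
    case True
    then have cz: "\<And>i. i \<noteq> k \<Longrightarrow> C_pattern B w $ i $ l = 0" by (simp add: C_def)
    have nz: "C $ k $ l \<noteq> 0" and g: "G $ k $ l = C $ k $ l" and g0: "\<And>j. j \<noteq> l \<Longrightarrow> G $ k $ j = 0"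
      using coordinate_c_vector[where k = k, OF d sc di cz] by (auto simp: C_def G_def)
    have \<theta>\<epsilon>: "\<theta> = \<epsilon>"
    proof -
      have "0 \<le> \<epsilon> * C $ k $ l" "0 \<le> \<theta> * G $ k $ l" "\<epsilon> = 1 \<or> \<epsilon> = -1" "\<theta> = 1 \<or> \<theta> = -1"
        using \<epsilon> \<theta> by (simp_all add: has_sign_def)
      then show ?thesis using nz g by auto
    qed
    have "(\<Sum>m\<in>UNIV. G $ k $ m * max (- \<epsilon> * A $ m $ l) 0) = 0"
      using g0 zA by (intro sum.neutral) (metis max.idem mult_zero_left mult_zero_right)
    then have "G_pattern B (l # w) $ k $ l = - G $ k $ l" unfolding G' by simp
    then have \<eta>: "\<eta> = - \<epsilon>"
      using has_sign_flip[OF \<theta> Cons.prems, of l] nz g \<theta>\<epsilon> by simp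
    have "(\<Sum>m\<in>UNIV. max (- \<theta> * B $ k $ m) 0 * C $ m $ l) = 0"
      using True z by (intro sum.neutral) (metis max.idem mult_zero_left mult_zero_right)
    then have "C1 $ k $ l = - C $ k $ l"
      unfolding IH signed_step_mult[where A = B, OF z] by simp
    then have \<epsilon>1: "\<epsilon>1 = - \<epsilon>"
      using has_sign_flip[OF \<epsilon> \<epsilon>1, of k] nz by simp
    have s: "\<epsilon> = 1 \<or> \<epsilon> = -1" using \<epsilon> by (simp add: has_sign_def)
    have key: "row_part k B ** C = C ** row_part l A"
    proof -
      have "(row_part k B ** C) $ i $ j = (C ** row_part l A) $ i $ j" for i j
      proof (cases "i = k")
        case True
        have "(row_part k B ** C) $ k $ j = (B ** C) $ k $ j"
          by (simp add: row_part_mult_left) (simp add: matrix_matrix_mult_def)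
        also have "\<dots> = (G ** A) $ k $ j" using GB_eq_BC[OF sk, of w] by (simp add: G_def A_def C_def)
        also have "\<dots> = (\<Sum>m\<in>UNIV. if m = l then G $ k $ l * A $ l $ j else 0)"
          unfolding matrix_matrix_mult_def vec_lambda_beta by (intro sum.cong) (auto simp: g0)
        finally show ?thesis using True by (simp add: g row_part_mult)
      next
        case False
        then show ?thesis using True
          by (simp add: row_part_mult row_part_mult_left C_def)
      qed
      then show ?thesis by (simp add: vec_eq_iff)
    qed
    \<comment> \<open>The claim is \<open>Y C Z = X C W\<close>. As \<open>X\<close> and \<open>Z\<close> are involutions, it amounts to
      \<open>X Y C = C W Z\<close>, where only the single rows of \<open>B\<close> and \<open>A\<close> remain.\<close>
    define X Y W Z where "X = signed_step (- \<epsilon>) k B" and "Y = signed_step \<epsilon> k B"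
      and "W = signed_step (- \<epsilon>) l A" and "Z = signed_step \<epsilon> l A"
    have XX: "X ** X = mat 1" and ZZ: "Z ** Z = mat 1"
      unfolding X_def Z_def using signed_step_involution z zA by blast+
    have XY: "X ** Y = mat 1 - \<epsilon> *\<^sub>R row_part k B" and WZ: "W ** Z = mat 1 - \<epsilon> *\<^sub>R row_part l A"
      unfolding X_def Y_def W_def Z_def using signed_step_opposite z zA s by blast+
    have "X ** Y ** C = C ** (W ** Z)"
    proof -
      have "(mat 1 - \<epsilon> *\<^sub>R R) ** C = C - \<epsilon> *\<^sub>R (R ** C)" "C ** (mat 1 - \<epsilon> *\<^sub>R R) = C - \<epsilon> *\<^sub>R (C ** R)" for R
        by (simp_all add: vec_eq_iff matrix_matrix_mult_def mat_def left_diff_distrib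
            right_diff_distrib sum_subtractf sum_distrib_left mult_ac
            if_distrib[where f = "\<lambda>a. a * _"] if_distrib[where f = "\<lambda>a. _ * a"] cong: if_cong)
      then show ?thesis by (simp add: XY WZ key)
    qed
    then have "X ** (X ** Y ** C) ** Z = X ** (C ** (W ** Z)) ** Z" by simp
    then have "(X ** X) ** Y ** C ** Z = X ** C ** W ** (Z ** Z)" by (simp only: matrix_mul_assoc)
    then have "Y ** C ** Z = X ** C ** W" by (simp add: XX ZZ)
    then show ?thesis
      unfolding C1' C' IH \<epsilon>1 \<eta> \<theta>\<epsilon> by (simp add: X_def Y_def W_def Z_def matrix_mul_assoc)
  next
    case False
    then obtain i where i: "i \<noteq> k" "C $ i $ l \<noteq> 0" by blast
    have "C1 $ i $ l = C $ i $ l"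
      unfolding IH signed_step_mult[where A = B, OF z] using i by simp
    then have \<epsilon>1: "\<epsilon>1 = \<epsilon>" using has_sign_unique[OF \<epsilon> \<epsilon>1, of i] i by simp
    \<comment> \<open>Mutation keeps all entries of row \<open>k\<close> of \<open>G\<close> outside column \<open>l\<close>, so one nonzero entry there
      preserves the sign of the row.\<close>
    have "\<exists>j. j \<noteq> l \<and> G $ k $ j \<noteq> 0"
    proof (rule ccontr)
      assume "\<not> ?thesis"
      then have g0: "\<And>j. j \<noteq> l \<Longrightarrow> G $ k $ j = 0" by blast
      have pos: "d $ i > 0" for i using d unfolding skew_symmetrizer_entry by blast
      have "(\<Sum>q\<in>UNIV. C $ i $ q * G $ k $ q / d $ q) = 0"
        using dual_bases_rows[OF dual_bases_patterns[OF d sc] pos i(1)] by (simp add: C_def G_def)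
      moreover have "(\<Sum>q\<in>UNIV. C $ i $ q * G $ k $ q / d $ q) =
          (\<Sum>q\<in>UNIV. if q = l then C $ i $ l * G $ k $ l / d $ l else 0)"
        using g0 by (intro sum.cong) auto
      ultimately have "C $ i $ l * G $ k $ l / d $ l = 0" by simp
      then have "G $ k $ l = 0" using i(2) pos[of l] by simp
      then have "row k G = 0" using g0 by (metis row_def vec_eq_iff vec_lambda_beta zero_index)
      then show False
        using sign_coherent_word(2)[OF sk sc, of k w] by (simp add: G_def sign_coherent_vec_def)
    qed
    then obtain j where "j \<noteq> l" "G $ k $ j \<noteq> 0" by blast
    moreover have "G $ k $ j = G_pattern B (l # w) $ k $ j" using calculation unfolding G' by simp
    ultimately have "\<eta> = \<theta>" using has_sign_unique[OF \<theta> Cons.prems, of j] by blast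
    then show ?thesis unfolding C1' C' IH \<epsilon>1 by (simp add: matrix_mul_assoc)
  qed
qed


section \<open>Rigidity of the scaling factors\<close>

text \<open>Reverse induction on \<open>w\<close> moves the initial vertex one step at a time along the path to \<open>w\<close>; the
  other word grows by a letter at each step and so has to be arbitrary.\<close>

lemma C_pattern_scaling_rigid:
  assumes "skew_symmetrizer d B" "hypothesis_H B"
    and "monomial_related \<sigma> m (C_pattern B w) (C_pattern B w')"
  shows "m i = sqrt (d $ i / d $ \<sigma> i)"
  using assms
proof (induction w arbitrary: B w' rule: rev_induct)
  case Nil
  have "column i (C_pattern B w') = m i *\<^sub>R axis (\<sigma> i) 1" "m i > 0"
    using Nil by (auto simp: monomial_related_def column_def mat_def axis_def vec_eq_iff)
  then show ?case
    using discrete_word[OF Nil(1) hypothesis_H_self(2)[OF Nil(2)]] by force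
next
  case (snoc k w)
  let ?t = "w @ [k]"
  note d = snoc(2) and H = snoc(3) and rel = snoc(4)
  have sk: "skew_symmetrizable B" using d by (auto simp: skew_symmetrizable_def)
  have sc: "sign_coherent B" using hypothesis_H_self[OF H] by simp
  have pos: "d $ i > 0" for i using d unfolding skew_symmetrizer_entry by blast
  have d1: "skew_symmetrizer d (mutation k B)" using d by (rule skew_symmetrizer_mutation)
  then have sk1: "skew_symmetrizable (mutation k B)" by (auto simp: skew_symmetrizable_def)
  have g: "monomial_related \<sigma> (\<lambda>i. d $ i / (d $ \<sigma> i * m i)) (G_pattern B ?t) (G_pattern B w')"
    using monomial_related_dual[OF dual_bases_patterns[OF d sc] dual_bases_patterns[OF d sc] pos rel] .
  obtain \<eta> where \<eta>: "has_sign \<eta> (\<lambda>j. G_pattern B ?t $ k $ j)"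
    using sign_coherent_vec_has_sign[OF sign_coherent_word(2)[OF sk sc, of k ?t]]
    by (auto simp: row_def)
  \<comment> \<open>The \<open>k\<close>-th rows of the two G-matrices agree up to a permutation and positive factors, so both
    C-matrices are multiplied by the same signed step.\<close>
  have \<eta>': "has_sign \<eta> (\<lambda>j. G_pattern B w' $ k $ j)"
    unfolding has_sign_def
  proof (intro conjI allI)
    show "\<eta> = 1 \<or> \<eta> = - 1" using \<eta> by (simp add: has_sign_def)
    fix j
    let ?f = "d $ j / (d $ \<sigma> j * m j)"
    have "column j (G_pattern B w') $ k = (?f *\<^sub>R column (\<sigma> j) (G_pattern B ?t)) $ k" and f: "?f > 0"
      using g by (auto simp: monomial_related_def)
    then have "\<eta> * G_pattern B w' $ k $ j = ?f * (\<eta> * G_pattern B ?t $ k $ \<sigma> j)"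
      by (simp add: column_def)
    moreover have "0 \<le> \<eta> * G_pattern B ?t $ k $ \<sigma> j"
      using \<eta> unfolding has_sign_def by blast
    ultimately show "0 \<le> \<eta> * G_pattern B w' $ k $ j"
      using f by (metis less_imp_le mult_nonneg_nonneg)
  qed
  have e: "C_pattern (mutation k B) w = signed_step (- \<eta>) k B ** C_pattern B ?t"
    using C_pattern_change_initial[OF d H \<eta>] pattern_cancel_initial(2)[OF sk1, of w k] by simp
  have e': "C_pattern (mutation k B) (w' @ [k]) = signed_step (- \<eta>) k B ** C_pattern B w'"
    by (rule C_pattern_change_initial[OF d H \<eta>'])
  have col: "column j (M ** X) = M *v column j X" for j and M X :: "real^'a^'a"
    by (simp add: vec_eq_iff column_def matrix_matrix_mult_def matrix_vector_mult_def)
  have "monomial_related \<sigma> m (C_pattern (mutation k B) w) (C_pattern (mutation k B) (w' @ [k]))"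
    using rel unfolding e e' by (simp add: monomial_related_def col matrix_vector_mult_scaleR)
  then show ?case
    using snoc.IH d1 hypothesis_H_mutation[OF H sk] by blast
qed


section \<open>Comparison of the exchange graphs\<close>

theorem theorem10p7:
  fixes B :: "real^'n::finite^'n" and d :: "real^'n"
  assumes "CARD('n) \<ge> 2"
    and "skew_symmetrizable B"
    and "skew_symmetrizer d B"
    and "sign_coherent B"
  shows "(EG_mod_C d B \<cong>\<^sub>c EG_mod_G d B) \<and>
         (hypothesis_H B \<longrightarrow>
            EG_mod_C d B \<cong>\<^sub>c EG_mod_G d B \<and> EG_mod_G d B \<cong>\<^sub>c EG_fan B) \<and>
         (hypothesis_H B \<longrightarrow> EG_C B \<cong>\<^sub>c EG_G B) \<and>
         (hypothesis_H B \<longrightarrow>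
            EG_mod_C d B \<cong>\<^sub>c EG_mod_G d B \<and> EG_mod_G d B \<cong>\<^sub>c EG_fan B \<and>
            EG_fan B \<cong>\<^sub>c EG_C_scaled B \<and> EG_C_scaled B \<cong>\<^sub>c EG_G_scaled B)"
proof -
  let ?C = "C_pattern B" and ?G = "G_pattern B"
  let ?s = "\<lambda>\<sigma> i. sqrt (d $ i / d $ \<sigma> i)"
  have pos: "d $ i > 0" for i using assms(3) unfolding skew_symmetrizer_entry by blast
  note CG = dual_bases_patterns[OF assms(3,4)]
  note GC = dual_bases_sym[OF CG]
  have iC: "invertible (?C t)" and iG: "invertible (?G t)" for t
    using dual_bases_invertible[OF CG pos] by blast+
  have to_G: "monomial_related \<sigma> (\<lambda>i. d $ i / (d $ \<sigma> i * l i)) (?G t) (?G t')"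
    if "monomial_related \<sigma> l (?C t) (?C t')" for \<sigma> l t t'
    using monomial_related_dual[OF CG CG pos that] .
  have to_C: "monomial_related \<sigma> (\<lambda>i. d $ i / (d $ \<sigma> i * l i)) (?C t) (?C t')"
    if "monomial_related \<sigma> l (?G t) (?G t')" for \<sigma> l t t'
    using monomial_related_dual[OF GC GC pos that] .
  \<comment> \<open>The factors \<open>?s \<sigma>\<close> of the modified patterns are fixed when passing to dual bases.\<close>
  have self: "d $ i / (d $ \<sigma> i * ?s \<sigma> i) = ?s \<sigma> i" for \<sigma> i
    by (metis divide_divide_eq_left real_div_sqrt divide_nonneg_nonneg less_imp_le pos)
  have mod_to_G: "monomial_related \<sigma> (?s \<sigma>) (?G t) (?G t')"
    if "monomial_related \<sigma> (?s \<sigma>) (?C t) (?C t')" for \<sigma> t t'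
    using to_G[OF that] unfolding self .
  have mod_to_C: "monomial_related \<sigma> (?s \<sigma>) (?C t) (?C t')"
    if "monomial_related \<sigma> (?s \<sigma>) (?G t) (?G t')" for \<sigma> t t'
    using to_C[OF that] unfolding self .
  have mod: "columns (mod_C_pattern d B t) = columns (mod_C_pattern d B t') \<longleftrightarrow>
      columns (mod_G_pattern d B t) = columns (mod_G_pattern d B t')" for t t'
    unfolding mod_C_pattern_def mod_G_pattern_def
      columns_diag_inv_sqrt_eq_iff[OF iC iC pos] columns_diag_inv_sqrt_eq_iff[OF iG iG pos]
    using mod_to_G mod_to_C by blast
  then have a: "EG_mod_C d B \<cong>\<^sub>c EG_mod_G d B"
    by (simp add: EG_mod_C_def EG_mod_G_def cluster_graph_def canonically_isomorphic_def)
  {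
    assume H: "hypothesis_H B"
    have rC: "l = ?s \<sigma>" if "monomial_related \<sigma> l (?C t) (?C t')" for \<sigma> l t t'
      using C_pattern_scaling_rigid[OF assms(3) H that] by blast
    have rG: "l = ?s \<sigma>" if "monomial_related \<sigma> l (?G t) (?G t')" for \<sigma> l t t'
    proof
      fix i
      have "l i > 0" using that by (simp add: monomial_related_def)
      moreover have "d $ i / (d $ \<sigma> i * l i) = ?s \<sigma> i"
        using rC[OF to_C[OF that]] by meson
      ultimately have "l i = d $ i / (d $ \<sigma> i * ?s \<sigma> i)"
        using pos[of i] pos[of "\<sigma> i"] by (simp add: field_simps)
      then show "l i = ?s \<sigma> i" by (simp only: self)
    qed
    have fan: "columns (mod_G_pattern d B t) = columns (mod_G_pattern d B t') \<longleftrightarrow>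
        G_cone (?G t) = G_cone (?G t')" for t t'
      unfolding mod_G_pattern_def columns_diag_inv_sqrt_eq_iff[OF iG iG pos] G_cone_eq_iff[OF iG iG]
      using rG by blast
    have sG: "G_cone (?G t) = G_cone (?G t') \<longleftrightarrow> (columns (?G t), columns (?G t')) \<in> scaling_equiv" for t t'
      by (simp add: G_cone_eq_iff[OF iG iG] scaling_equiv_columns_iff[OF iG iG])
    have sC: "(columns (?C t), columns (?C t')) \<in> scaling_equiv \<longleftrightarrow>
        (columns (?G t), columns (?G t')) \<in> scaling_equiv" for t t'
      unfolding scaling_equiv_columns_iff[OF iG iG] scaling_equiv_columns_iff[OF iC iC]
      using to_G to_C by blast
    have one: "(\<lambda>i. d $ i / (d $ \<sigma> i * 1)) = (\<lambda>_. 1)" if "(\<lambda>_. 1) = ?s \<sigma>" for \<sigma>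
    proof
      fix i
      show "d $ i / (d $ \<sigma> i * 1) = 1" using fun_cong[OF that, of i] by simp
    qed
    have "monomial_related \<sigma> (\<lambda>_. 1) (?G t) (?G t')"
      if "monomial_related \<sigma> (\<lambda>_. 1) (?C t) (?C t')" for \<sigma> t t'
      using to_G[OF that] unfolding one[OF rC[OF that]] .
    moreover have "monomial_related \<sigma> (\<lambda>_. 1) (?C t) (?C t')"
      if "monomial_related \<sigma> (\<lambda>_. 1) (?G t) (?G t')" for \<sigma> t t'
      using to_C[OF that] unfolding one[OF rG[OF that]] .
    ultimately have "columns (?C t) = columns (?C t') \<longleftrightarrow> columns (?G t) = columns (?G t')" for t t'
      unfolding columns_eq_iff[OF iC iC] columns_eq_iff[OF iG iG] by blast
    then have "EG_C B \<cong>\<^sub>c EG_G B"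
      by (simp add: EG_C_def EG_G_def cluster_graph_def canonically_isomorphic_def)
    moreover have "EG_mod_G d B \<cong>\<^sub>c EG_fan B"
      by (simp add: EG_mod_G_def EG_fan_def cluster_graph_def canonically_isomorphic_def fan)
    moreover have "EG_fan B \<cong>\<^sub>c EG_C_scaled B"
      by (simp add: EG_C_scaled_def EG_fan_def scaled_cluster_graph_def canonically_isomorphic_def sC sG)
    moreover have "EG_C_scaled B \<cong>\<^sub>c EG_G_scaled B"
      by (simp add: EG_C_scaled_def EG_G_scaled_def scaled_cluster_graph_def canonically_isomorphic_def sC)
    ultimately have "EG_C B \<cong>\<^sub>c EG_G B \<and> EG_mod_G d B \<cong>\<^sub>c EG_fan B \<and> EG_fan B \<cong>\<^sub>c EG_C_scaled B \<and>
        EG_C_scaled B \<cong>\<^sub>c EG_G_scaled B" by blast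
  }
  then show ?thesis using a by blast
qed

end
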